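(* Let $\mathbf{A}\in\mathbb{R}^{n\times d}$ have rank $r$ and let $\epsilon\in(0,1)$. Run Algorithm 4 (defined in the context) on $\mathbf{A}$ and $\epsilon$. Then the output $\widetilde{\mathbf{A}}_n$ is a $(1\pm\epsilon)$-spectral approximation for $\mathbf{A}$, and its expected number of rows is $\mathrm{O}\left(r\epsilon^{-2}\log\mu(\mathbf{A})+r\epsilon^{-2}\right)$.
   Context: For a matrix $\mathbf{A}\in\mathbb{R}^{n\times d}$, $\mathbf{a}_i^\top$ denotes its $i$-th row, $\mathbf{A}_i$ the matrix formed by its first $i$ rows, $\mathbf{M}^+$ the Moore–Penrose pseudo-inverse. $\widetilde{\mathbf{A}}$ is a $(1\pm\epsilon)$-spectral approximation for $\mathbf{A}$ if $(1-\epsilon)\mathbf{A}^\top\mathbf{A}\preceq\widetilde{\mathbf{A}}^\top\widetilde{\mathbf{A}}\preceq(1+\epsilon)\mathbf{A}^\top\mathbf{A}$. $\mu(\mathbf{A})=\|\mathbf{A}\|_2^2/\min_i\sigma_{\min}(\mathbf{A}_i)^2$, where $\sigma_{\min}$ is the smallest nonzero singular value and the minimum is over $i$ with $\mathbf{A}_i\ne\mathbf{O}$. Algorithm 4: set $c_U=2/\epsilon+1$, $c_L=3/\epsilon-1$, $\widetilde{\mathbf{A}}_0=\mathbf{O}$, $\mathbf{B}^U_0=\mathbf{B}^L_0=\mathbf{O}$ ($d\times d$). For $i=1,\dots,n$: let $\mathbf{X}^U_{i-1}=\mathbf{B}^U_{i-1}-\widetilde{\mathbf{A}}_{i-1}^\top\widetilde{\mathbf{A}}_{i-1}+\mathbf{a}_i\mathbf{a}_i^\top$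 and $\mathbf{X}^L_{i-1}=\widetilde{\mathbf{A}}_{i-1}^\top\widetilde{\mathbf{A}}_{i-1}-\mathbf{B}^L_{i-1}+\mathbf{a}_i\mathbf{a}_i^\top$; set $p_i=\min\left(c_U\mathbf{a}_i^\top(\mathbf{X}^U_{i-1})^+\mathbf{a}_i+c_L\mathbf{a}_i^\top(\mathbf{X}^L_{i-1})^+\mathbf{a}_i,1\right)$; with probability $p_i$ (independently) append the row $\mathbf{a}_i^\top/\sqrt{p_i}$ to $\widetilde{\mathbf{A}}_{i-1}$ to get $\widetilde{\mathbf{A}}_i$, otherwise $\widetilde{\mathbf{A}}_i=\widetilde{\mathbf{A}}_{i-1}$; then $\mathbf{B}^U_i=\mathbf{B}^U_{i-1}+(1+\epsilon)\mathbf{a}_i\mathbf{a}_i^\top$, $\mathbf{B}^L_i=\mathbf{B}^L_{i-1}+(1-\epsilon)\mathbf{a}_i\mathbf{a}_i^\top$. Output $\widetilde{\mathbf{A}}_n$. *)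

theory Defs
  imports "Jordan_Normal_Form.Char_Poly" "Jordan_Normal_Form.DL_Rank"
    "HOL-Probability.Probability_Mass_Function"
begin

definition mrank :: "real mat \<Rightarrow> nat" where
  "mrank A = vec_space.rank (dim_row A) A"

definition loewner_le :: "real mat \<Rightarrow> real mat \<Rightarrow> bool" where
  "loewner_le A B \<longleftrightarrow> (\<forall>x \<in> carrier_vec (dim_row A). x \<bullet> (A *\<^sub>v x) \<le> x \<bullet> (B *\<^sub>v x))"

definition spectral_approx :: "real \<Rightarrow> real mat \<Rightarrow> real mat \<Rightarrow> bool" where
  "spectral_approx eps A At \<longleftrightarrow> dim_col At = dim_col A \<and>
     loewner_le ((1 - eps) \<cdot>\<^sub>m (A\<^sup>T * A)) (At\<^sup>T * At) \<and>
     loewner_le (At\<^sup>T * At) ((1 + eps) \<cdot>\<^sub>m (A\<^sup>T * A))"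

definition singular_values :: "real mat \<Rightarrow> real set" where
  "singular_values A = {sqrt l | l. eigenvalue (A\<^sup>T * A) l}"

definition spec_norm :: "real mat \<Rightarrow> real" where
  "spec_norm A = (if singular_values A = {} then 0 else Max (singular_values A))"

definition sigma_min :: "real mat \<Rightarrow> real" where
  "sigma_min A = Min (singular_values A - {0})"

definition first_rows :: "nat \<Rightarrow> real mat \<Rightarrow> real mat" where
  "first_rows i A = mat_of_rows (dim_col A) (take i (Matrix.rows A))"

definition mu :: "real mat \<Rightarrow> real" where
  "mu A = (spec_norm A)\<^sup>2 /
     Min {(sigma_min (first_rows i A))\<^sup>2 | i. 1 \<le> i \<and> i \<le> dim_row A \<and>
            first_rows i A \<noteq> 0\<^sub>m i (dim_col A)}"

definition pinv :: "real mat \<Rightarrow> real mat" where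
  "pinv M = (THE X. X \<in> carrier_mat (dim_col M) (dim_row M) \<and>
       M * X * M = M \<and> X * M * X = X \<and> (M * X)\<^sup>T = M * X \<and> (X * M)\<^sup>T = X * M)"

definition outer :: "real Matrix.vec \<Rightarrow> real mat" where
  "outer a = Matrix.mat (dim_vec a) (dim_vec a) (\<lambda>(i, j). a $ i * a $ j)"

definition gram :: "nat \<Rightarrow> real Matrix.vec list \<Rightarrow> real mat" where
  "gram d rs = (mat_of_rows d rs)\<^sup>T * mat_of_rows d rs"

text \<open>State of Algorithm 4: (rows of At_{i-1}, B^U_{i-1}, B^L_{i-1}).\<close>
type_synonym alg_state = "real Matrix.vec list \<times> real mat \<times> real mat"

definition alg4_prob :: "real \<Rightarrow> nat \<Rightarrow> alg_state \<Rightarrow> real Matrix.vec \<Rightarrow> real" where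
  "alg4_prob eps d s a = (case s of (rs, BU, BL) \<Rightarrow>
     let cU = 2 / eps + 1; cL = 3 / eps - 1;
         XU = BU - gram d rs + outer a;
         XL = gram d rs - BL + outer a
     in min (cU * (a \<bullet> (pinv XU *\<^sub>v a)) + cL * (a \<bullet> (pinv XL *\<^sub>v a))) 1)"

definition alg4_step :: "real \<Rightarrow> nat \<Rightarrow> alg_state \<Rightarrow> real Matrix.vec \<Rightarrow> alg_state pmf" where
  "alg4_step eps d s a = (case s of (rs, BU, BL) \<Rightarrow>
     let p = alg4_prob eps d s a in
     map_pmf (\<lambda>b. (if b then rs @ [(1 / sqrt p) \<cdot>\<^sub>v a] else rs,
                   BU + (1 + eps) \<cdot>\<^sub>m outer a,
                   BL + (1 - eps) \<cdot>\<^sub>m outer a))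
       (bernoulli_pmf p))"

definition alg4 :: "real \<Rightarrow> real mat \<Rightarrow> real mat pmf" where
  "alg4 eps A = (let d = dim_col A in
     map_pmf (\<lambda>(rs, _, _). mat_of_rows d rs)
       (foldl (\<lambda>M a. bind_pmf M (\<lambda>s. alg4_step eps d s a))
              (return_pmf ([], 0\<^sub>m d d, 0\<^sub>m d d)) (Matrix.rows A)))"

end

(*
Both barriers are preserved surely: a row a that is dropped or rescaled by 1/p moves
X^U or X^L by a multiple of a a^T, and p >= a^T X^+ a keeps the result positive semidefinite.

For the expected number of rows, fix the step i with Gram matrix G_i = A_i^T A_i and, for j < i, put
  Y_j = (eps/2) G_i + theta I +/- ((1 +/- eps/2) A_j^T A_j - At_j^T At_j).
By the Sherman-Morrison formula the sampling probabilities make a_i^T Y_j^{-1} a_i a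
supermartingale in j.  At j = i - 1 it dominates a_i^T X^+ a_i up to a factor 2 once theta is small
(the ridge theta I only serves to replace pseudo-inverses by inverses, and finitely many states
occur), while at j = 0 it is at most (4/eps) a_i^T (G_i + m I)^{-1} a_i, where m is the denominator
of mu(A).  The latter scores sum to at most r ln(1 + mu(A)): by the matrix determinant lemma they
telescope into ln det(G_n + m I) - ln det(m I).
*)
theory Submission
  imports Defs "Jordan_Normal_Form.Spectral_Radius" "Jordan_Normal_Form.Schur_Decomposition"
begin

unbundle no inner_syntax
unbundle no vec_syntax

subsection \<open>Diagonalization of real symmetric matrices\<close>

text \<open>The allowance eps of each barrier is split in two. One half is set aside from the start
  as (eps/2) G_i, which gives the process a useful initial matrix; the other half stays in the
  slopes 1 +/- eps/2, so that a step moves Y_j on average by (eps/2) a a^T. This drift has to be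
  positive because inversion is convex: fluctuation without drift would raise the expected score. At
  j = i - 1 the halves recombine, and Y_j is X^U or X^L minus (1 - eps/2) a a^T plus the ridge. The
  drift wins once p >= (2/eps) (1 +/- eps/2) a^T X^+ a. The upper version of this factor is c_U =
  2/eps + 1; the lower one is 2/eps - 1, which lies below c_L. Since Gram matrices may be singular,
  scores are handled through solutions of M y = a and a Cauchy-Schwarz inequality instead of inverse
  matrices. The spectral theorem serves the existence of \<open>pinv\<close> and the link between
  singular values, rank and determinant. The constant 48 arises from p <= (3/eps) times the sum of
  the two barrier scores, each of which has expectation at most 8/eps times the ridge score.\<close>

lemma symmetric_real_eigenvalue_exists:
  fixes A :: "real mat"
  assumes A: "A \<in> carrier_mat n n" and sym: "A\<^sup>T = A" and n: "0 < n"
  shows "\<exists>e. eigenvalue A e"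
proof -
  \<comment> \<open>Over the complex numbers an eigenvalue exists. Symmetry of the real matrix and
    the conjugate scalar product force it to be real, so it is already a root of the real
    characteristic polynomial.\<close>
  define C where "C = map_mat complex_of_real A"
  have C: "C \<in> carrier_mat n n" using A by (simp add: C_def)
  have symC: "C\<^sup>T = C" unfolding C_def using sym by (metis map_mat_transpose)
  obtain k where k: "eigenvalue C k"
    using spectrum_non_empty[OF C n] by (auto simp: spectrum_def)
  then obtain w where w: "w \<in> carrier_vec n" "w \<noteq> 0\<^sub>v n" "C *\<^sub>v w = k \<cdot>\<^sub>v w"
    using C by (auto simp: eigenvalue_def eigenvector_def)
  have cC: "conjugate (C *\<^sub>v w) = C *\<^sub>v conjugate w"
    using A w(1) by (auto simp: C_def scalar_prod_def intro!: eq_vecI)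
  have cw: "conjugate w \<in> carrier_vec n" using w(1) by simp
  have "k * (w \<bullet>c w) = (C *\<^sub>v w) \<bullet>c w"
    using w cw by simp
  also have "\<dots> = w \<bullet> (C *\<^sub>v conjugate w)"
    using transpose_vec_mult_scalar[OF C cw w(1)] symC comm_scalar_prod[OF _ cw, of "C *\<^sub>v w"]
      comm_scalar_prod[OF w(1), of "C *\<^sub>v conjugate w"] C w(1) cw 
    by (metis mult_mat_vec_carrier transpose_vec_mult_scalar)
  also have "\<dots> = w \<bullet> conjugate (k \<cdot>\<^sub>v w)" using cC w(3) by simp
  also have "\<dots> = cnj k * (w \<bullet>c w)"
    using w(1) cw by (simp add: conjugate_smult_vec)
  finally have "k * (w \<bullet>c w) = cnj k * (w \<bullet>c w)" .
  moreover have "w \<bullet>c w \<noteq> 0" using w(1,2) by simp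
  ultimately have "k = cnj k" by simp
  then have kr: "k = complex_of_real (Re k)" by (metis Reals_cnj_iff of_real_Re)
  have "poly (char_poly C) (complex_of_real (Re k)) = 0"
    using k kr eigenvalue_root_char_poly[OF C] by simp
  then have "poly (char_poly A) (Re k) = 0"
    unfolding C_def of_real_hom.char_poly_hom[OF A] by (simp add: of_real_hom.poly_map_poly)
  then show ?thesis using eigenvalue_root_char_poly[OF A] by blast
qed

lemma scalar_prod_self_nonneg: "0 \<le> v \<bullet> (v :: real Matrix.vec)"
  by (auto simp: scalar_prod_def intro!: sum_nonneg)

text \<open>Gram-Schmidt keeps the head of its list, so after normalization the first column is a
  multiple of \<open>v\<close>. This is the rotation that splits off one eigenvector in the
  diagonalization.\<close>

lemma orthonormal_completion:
  fixes v :: "real Matrix.vec"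
  assumes v: "v \<in> carrier_vec n" and v0: "v \<noteq> 0\<^sub>v n"
  shows "\<exists>W c. W \<in> carrier_mat n n \<and> W\<^sup>T * W = 1\<^sub>m n \<and> col W 0 = c \<cdot>\<^sub>v v"
proof -
  interpret cof_vec_space n "TYPE(real)" .
  define b where "b = basis_completion v"
  from basis_completion[OF v v0, folded b_def]
  have span_b: "span (set b) = carrier_vec n" and dist_b: "distinct b"
    and indep: "\<not> lin_dep (set b)" and b: "set b \<subseteq> carrier_vec n" and hdb: "hd b = v"
    and len_b: "length b = n" by auto
  have n: "n > 0" using v v0 by (cases n) auto
  with hdb len_b obtain vs where bv: "b = v # vs" by (cases b, auto)
  define ws where "ws = gram_schmidt n b"
  from gram_schmidt_result[OF b dist_b indep refl, folded ws_def]
  have ws: "set ws \<subseteq> carrier_vec n" "corthogonal ws" "length ws = n"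
    by (auto simp: len_b)
  from gram_schmidt_hd[OF v, of vs, folded bv] have hdws: "hd ws = v" unfolding ws_def .
  have ws0: "ws ! 0 = v" using hdws n ws(3) by (metis hd_conv_nth list.size(3) not_gr_zero)
  have wsc: "ws ! i \<in> carrier_vec n" if "i < n" for i using ws that by auto
  have orth: "(ws ! i \<bullet> ws ! j = 0) = (i \<noteq> j)" if "i < n" "j < n" for i j
    using corthogonalD[OF ws(2), of i j] that ws(3) by simp
  have pos: "ws ! i \<bullet> ws ! i > 0" if "i < n" for i
    using orth[OF that that] scalar_prod_self_nonneg[of "ws ! i"] by linarith
  define us where "us = map (\<lambda>w. (1 / sqrt (w \<bullet> w)) \<cdot>\<^sub>v w) ws"
  define W where "W = mat_of_cols n us"
  have W: "W \<in> carrier_mat n n" using ws(3) by (simp add: W_def us_def mat_of_cols_def)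
  have colW: "col W i = (1 / sqrt (ws ! i \<bullet> ws ! i)) \<cdot>\<^sub>v ws ! i" if "i < n" for i
    unfolding W_def using that ws(3) wsc[OF that]
    by (subst col_mat_of_cols) (auto simp: us_def)
  have "W\<^sup>T * W = 1\<^sub>m n"
  proof (rule eq_matI)
    fix i j assume ij: "i < dim_row (1\<^sub>m n :: real mat)" "j < dim_col (1\<^sub>m n :: real mat)"
    then have ij: "i < n" "j < n" by auto
    have "(W\<^sup>T * W) $$ (i,j) = col W i \<bullet> col W j" using W ij by simp
    also have "\<dots> = (ws ! i \<bullet> ws ! j) / (sqrt (ws ! i \<bullet> ws ! i) * sqrt (ws ! j \<bullet> ws ! j))"
      unfolding colW[OF ij(1)] colW[OF ij(2)]
      using wsc[OF ij(1)] wsc[OF ij(2)] by simp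
    also have "\<dots> = (1\<^sub>m n :: real mat) $$ (i,j)"
      using orth[OF ij] pos[OF ij(1)] ij by (cases "i = j") auto
    finally show "(W\<^sup>T * W) $$ (i,j) = (1\<^sub>m n :: real mat) $$ (i,j)" .
  qed (use W in auto)
  then show ?thesis using W colW[OF n] ws0 by metis
qed

text \<open>Deflation: in an orthonormal basis that starts with an eigenvector, the first column of
  the matrix is \<open>e\<close> times a unit vector, and by symmetry so is the first row. The
  induction hypothesis diagonalizes the remaining block \<open>D\<close>.\<close>

theorem symmetric_real_diagonalization:
  fixes A :: "real mat"
  assumes "A \<in> carrier_mat n n" and "A\<^sup>T = A"
  shows "\<exists>P f. P \<in> carrier_mat n n \<and> P\<^sup>T * P = 1\<^sub>m n \<and> A = P * mat_diag n f * P\<^sup>T"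
  using assms
proof (induction n arbitrary: A)
  case 0
  show ?case
    by (rule exI[of _ "1\<^sub>m 0"], rule exI[of _ "\<lambda>_. 0"]) (use 0 in \<open>auto intro!: eq_matI\<close>)
next
  case (Suc m)
  let ?n = "Suc m"
  note A = Suc.prems(1) and sym = Suc.prems(2)
  obtain e v where v: "v \<in> carrier_vec ?n" "v \<noteq> 0\<^sub>v ?n" "A *\<^sub>v v = e \<cdot>\<^sub>v v"
    using symmetric_real_eigenvalue_exists[OF A sym] A by (auto simp: eigenvalue_def eigenvector_def)
  obtain W c where W: "W \<in> carrier_mat ?n ?n" "W\<^sup>T * W = 1\<^sub>m ?n" "col W 0 = c \<cdot>\<^sub>v v"
    using orthonormal_completion[OF v(1,2)] by blast
  have WT: "W\<^sup>T \<in> carrier_mat ?n ?n" using W(1) by simp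
  have WWT: "W * W\<^sup>T = 1\<^sub>m ?n" using mat_mult_left_right_inverse[OF WT W(1) W(2)] .
  define B where "B = W\<^sup>T * A * W"
  have B: "B \<in> carrier_mat ?n ?n" using A W WT by (simp add: B_def)
  have symB: "B\<^sup>T = B"
    unfolding B_def using A W(1) WT sym
    by (simp add: transpose_mult[of _ ?n ?n _ ?n] assoc_mult_mat[of _ ?n ?n _ ?n _ ?n])
  have AB: "A = W * B * W\<^sup>T"
  proof -
    have "W * B * W\<^sup>T = (W * W\<^sup>T) * A * (W * W\<^sup>T)"
      unfolding B_def using A W(1) WT by (simp add: assoc_mult_mat[of _ ?n ?n _ ?n _ ?n])
    then show ?thesis using A by (simp add: WWT)
  qed
  have colB: "col B 0 = e \<cdot>\<^sub>v unit_vec ?n 0"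
  proof -
    have AW: "A * W \<in> carrier_mat ?n ?n" using A W(1) by simp
    have "B = W\<^sup>T * (A * W)"
      unfolding B_def using A W(1) WT by (simp add: assoc_mult_mat[of _ ?n ?n _ ?n _ ?n])
    then have "col B 0 = W\<^sup>T *\<^sub>v (A *\<^sub>v col W 0)"
      using col_mult2[OF WT AW, of 0] col_mult2[OF A W(1), of 0] by (simp only: zero_less_Suc)
    also have "A *\<^sub>v col W 0 = e \<cdot>\<^sub>v col W 0"
      unfolding W(3) using v A by (simp add: mult_mat_vec[of _ ?n ?n] smult_smult_assoc mult.commute)
    also have "W\<^sup>T *\<^sub>v (e \<cdot>\<^sub>v col W 0) = e \<cdot>\<^sub>v col (W\<^sup>T * W) 0"
      using mult_mat_vec[OF WT col_carrier_vec[OF _ W(1)], of 0 e] col_mult2[OF WT W(1), of 0]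
      by (simp only: zero_less_Suc)
    finally show ?thesis unfolding W(2) by simp
  qed
  have Bi0: "B $$ (i,0) = (if i = 0 then e else 0)" if "i < ?n" for i
    using arg_cong[OF colB, of "\<lambda>v. v $ i"] that B by auto
  have B0i: "B $$ (0,i) = (if i = 0 then e else 0)" if "i < ?n" for i
    using Bi0[OF that] symB that B by (metis carrier_matD(1,2) index_transpose_mat(1) zero_less_Suc)
  define D where "D = Matrix.mat m m (\<lambda>(i,j). B $$ (Suc i, Suc j))"
  have D: "D \<in> carrier_mat m m" by (simp add: D_def)
  have symD: "D\<^sup>T = D"
    using symB B unfolding D_def
    by (auto intro!: eq_matI) (metis Suc_less_eq carrier_matD(1,2) index_transpose_mat(1))
  obtain P f where P: "P \<in> carrier_mat m m" "P\<^sup>T * P = 1\<^sub>m m" "D = P * mat_diag m f * P\<^sup>T"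
    using Suc.IH[OF D symD] by blast
  define F where "F = four_block_mat (1\<^sub>m 1) (0\<^sub>m 1 m) (0\<^sub>m m 1) P"
  define g where "g = case_nat e f"
  have F: "F \<in> carrier_mat ?n ?n" unfolding F_def using four_block_carrier_mat[of "1\<^sub>m 1" 1 1 P m m] P(1) by simp
  have FT: "F\<^sup>T = four_block_mat (1\<^sub>m 1) (0\<^sub>m 1 m) (0\<^sub>m m 1) P\<^sup>T"
    unfolding F_def using P(1) by (subst transpose_four_block_mat) auto
  have PT: "P\<^sup>T \<in> carrier_mat m m" using P(1) by simp
  have FTF: "F\<^sup>T * F = 1\<^sub>m ?n"
    unfolding FT unfolding F_def
    using P(1) PT by (subst mult_four_block_mat[of _ 1 1 _ m _ m _ _ 1 _ m]) (auto simp: P(2) intro!: eq_matI)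
  have Gd: "mat_diag ?n g = four_block_mat (e \<cdot>\<^sub>m 1\<^sub>m 1) (0\<^sub>m 1 m) (0\<^sub>m m 1) (mat_diag m f)"
    by (rule eq_matI) (auto simp: mat_diag_def g_def split: nat.splits)
  have Bb: "B = four_block_mat (e \<cdot>\<^sub>m 1\<^sub>m 1) (0\<^sub>m 1 m) (0\<^sub>m m 1) D"
  proof (rule eq_matI)
    fix i j assume "i < dim_row (four_block_mat (e \<cdot>\<^sub>m 1\<^sub>m 1) (0\<^sub>m 1 m) (0\<^sub>m m 1) D)"
      "j < dim_col (four_block_mat (e \<cdot>\<^sub>m 1\<^sub>m 1) (0\<^sub>m 1 m) (0\<^sub>m m 1) D)"
    then have ij: "i < ?n" "j < ?n" using D by auto
    show "B $$ (i,j) = four_block_mat (e \<cdot>\<^sub>m 1\<^sub>m 1) (0\<^sub>m 1 m) (0\<^sub>m m 1) D $$ (i,j)"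
      using Bi0[of i] B0i[of j] ij B D by (cases i; cases j) (auto simp: D_def)
  qed (use B D in auto)
  have md: "mat_diag m f \<in> carrier_mat m m" by simp
  have Pf: "P * mat_diag m f \<in> carrier_mat m m" using P(1) md by (rule mult_carrier_mat)
  have z: "(0\<^sub>m 1 m :: real mat) * mat_diag m f = 0\<^sub>m 1 m" "(0\<^sub>m 1 m :: real mat) * P\<^sup>T = 0\<^sub>m 1 m"
    "P * mat_diag m f * 0\<^sub>m m 1 = 0\<^sub>m m 1" "P * 0\<^sub>m m 1 = 0\<^sub>m m 1"
    using left_mult_zero_mat[OF md] left_mult_zero_mat[OF PT]
      right_mult_zero_mat[OF Pf] right_mult_zero_mat[OF P(1)] by auto
  have "F * mat_diag ?n g = four_block_mat (e \<cdot>\<^sub>m 1\<^sub>m 1) (0\<^sub>m 1 m) (0\<^sub>m m 1) (P * mat_diag m f)"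
    unfolding F_def Gd
    by (subst mult_four_block_mat[of _ 1 1 _ m _ m _ _ 1 _ m]) (use P(1) Pf in \<open>simp_all add: z del: One_nat_def\<close>)
  then have "F * mat_diag ?n g * F\<^sup>T = four_block_mat (e \<cdot>\<^sub>m 1\<^sub>m 1) (0\<^sub>m 1 m) (0\<^sub>m m 1) (P * mat_diag m f * P\<^sup>T)"
    unfolding FT
    by (simp only:, subst mult_four_block_mat[of _ 1 1 _ m _ m _ _ 1 _ m])
      (use PT Pf mult_carrier_mat[OF Pf PT] in \<open>simp_all add: z del: One_nat_def\<close>)
  then have "F * mat_diag ?n g * F\<^sup>T = B" unfolding Bb P(3)[symmetric] .
  then have BF: "B = F * mat_diag ?n g * F\<^sup>T" ..
  have mdn: "mat_diag ?n g \<in> carrier_mat ?n ?n" by simp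
  have FTc: "F\<^sup>T \<in> carrier_mat ?n ?n" using F by simp
  have "(W * F)\<^sup>T * (W * F) = F\<^sup>T * (W\<^sup>T * W) * F"
    using W(1) F WT FTc
    by (simp add: transpose_mult[of _ ?n ?n _ ?n] assoc_mult_mat[of _ ?n ?n _ ?n _ ?n])
  then have "(W * F)\<^sup>T * (W * F) = 1\<^sub>m ?n" using F FTF W(2) FTc by simp
  moreover have "A = (W * F) * mat_diag ?n g * (W * F)\<^sup>T"
    unfolding AB BF using W(1) F WT FTc mdn
    by (simp add: transpose_mult[of _ ?n ?n _ ?n] assoc_mult_mat[of _ ?n ?n _ ?n _ ?n]
        mult_carrier_mat[of _ ?n ?n _ ?n])
  moreover have "W * F \<in> carrier_mat ?n ?n" using W(1) F by simp
  ultimately show ?case by blast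
qed

lemma symmetric_scalar_prod_swap:
  fixes M :: "real mat"
  assumes "M \<in> carrier_mat d d" "M\<^sup>T = M" "x \<in> carrier_vec d" "y \<in> carrier_vec d"
  shows "x \<bullet> (M *\<^sub>v y) = y \<bullet> (M *\<^sub>v x)"
  using transpose_vec_mult_scalar[OF assms(1,4,3)] assms comm_scalar_prod[of "M *\<^sub>v x" d y] by simp

lemma scalar_prod_self_eq_0_iff:
  fixes v :: "real Matrix.vec"
  assumes "v \<in> carrier_vec n"
  shows "v \<bullet> v = 0 \<longleftrightarrow> v = 0\<^sub>v n"
  using conjugate_square_eq_0_vec[OF assms] by simp

lemma scalar_prod_self_pos:
  fixes v :: "real Matrix.vec"
  assumes "v \<in> carrier_vec n" "v \<noteq> 0\<^sub>v n"
  shows "0 < v \<bullet> v"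
  using scalar_prod_self_eq_0_iff[OF assms(1)] assms(2) scalar_prod_self_nonneg[of v] by linarith

lemma vec_minus_eq_0D:
  fixes a b :: "real Matrix.vec"
  assumes "a \<in> carrier_vec d" "b \<in> carrier_vec d" and eq: "a - b = 0\<^sub>v d"
  shows "a = b"
proof (rule eq_vecI)
  fix i assume "i < dim_vec b"
  then have "(a - b) $ i = 0" using assms by (simp only: eq) simp
  then show "a $ i = b $ i" using assms(1,2) \<open>i < dim_vec b\<close> by simp
qed (use assms in auto)

lemma smult_mat_mult_vec:
  fixes A :: "real mat"
  assumes "A \<in> carrier_mat n d" "x \<in> carrier_vec d"
  shows "(c \<cdot>\<^sub>m A) *\<^sub>v x = c \<cdot>\<^sub>v (A *\<^sub>v x)"
  using assms by (intro eq_vecI) auto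

subsection \<open>Pseudo-inverses of symmetric matrices\<close>

text \<open>\<open>pinv\<close> is a definite description, so nothing can be said about it before
  the Penrose conditions are shown to have exactly one solution.\<close>

lemma pinv_symmetric:
  fixes M :: "real mat"
  assumes M: "M \<in> carrier_mat d d" and sym: "M\<^sup>T = M"
  shows "pinv M \<in> carrier_mat d d" "M * pinv M * M = M" "(M * pinv M)\<^sup>T = M * pinv M"
proof -
  let ?Q = "\<lambda>X. X \<in> carrier_mat (dim_col M) (dim_row M) \<and>
       M * X * M = M \<and> X * M * X = X \<and> (M * X)\<^sup>T = M * X \<and> (X * M)\<^sup>T = X * M"
  obtain P f where P: "P \<in> carrier_mat d d" "P\<^sup>T * P = 1\<^sub>m d" "M = P * mat_diag d f * P\<^sup>T"
    using symmetric_real_diagonalization[OF M sym] by blast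
  have PT: "P\<^sup>T \<in> carrier_mat d d" using P(1) by simp
  have conj_mult: "(P * mat_diag d g * P\<^sup>T) * (P * mat_diag d h * P\<^sup>T)
      = P * mat_diag d (\<lambda>i. g i * h i) * P\<^sup>T" for g h
  proof -
    have "(P * mat_diag d g * P\<^sup>T) * (P * mat_diag d h * P\<^sup>T)
        = P * mat_diag d g * (P\<^sup>T * P) * mat_diag d h * P\<^sup>T"
      using P(1) PT by (simp add: assoc_mult_mat[of _ d d _ d _ d] mult_carrier_mat[of _ d d _ d])
    also have "\<dots> = P * (mat_diag d g * mat_diag d h) * P\<^sup>T"
      unfolding P(2) using right_mult_one_mat[of "P * mat_diag d g" d d]
        assoc_mult_mat[OF P(1) mat_diag_dim mat_diag_dim, of g h] P(1) by simp
    finally show ?thesis by simp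
  qed
  have conj_sym: "(P * mat_diag d g * P\<^sup>T)\<^sup>T = P * mat_diag d g * P\<^sup>T" for g
  proof -
    have "(mat_diag d g)\<^sup>T = mat_diag d g" by (rule eq_matI) (auto simp: mat_diag_def)
    then show ?thesis
      using P(1) PT by (simp add: transpose_mult[of _ d d _ d] assoc_mult_mat[of _ d d _ d _ d] mult_carrier_mat[of _ d d _ d])
  qed
  \<comment> \<open>Since \<open>inverse 0 = 0\<close>, kernel directions are sent to zero, as the
    Penrose conditions demand.\<close>
  define X where "X = P * mat_diag d (\<lambda>i. inverse (f i)) * P\<^sup>T"
  have "X \<in> carrier_mat d d" unfolding X_def using P(1) PT by (simp add: mult_carrier_mat[of _ d d _ d])
  moreover have inv3: "(\<lambda>i. f i * inverse (f i) * f i) = f"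
    "(\<lambda>i. inverse (f i) * f i * inverse (f i)) = (\<lambda>i. inverse (f i))"
  proof -
    have "f i * inverse (f i) * f i = f i" "inverse (f i) * f i * inverse (f i) = inverse (f i)" for i
      by (cases "f i = 0"; simp)+
    then show "(\<lambda>i. f i * inverse (f i) * f i) = f"
      "(\<lambda>i. inverse (f i) * f i * inverse (f i)) = (\<lambda>i. inverse (f i))" by auto
  qed
  ultimately have QX: "?Q X"
    unfolding X_def P(3) conj_mult conj_sym inv3 using P(1) PT by simp
  \<comment> \<open>For two solutions, \<open>M * X\<close> and \<open>M * Y\<close> are symmetric
    and absorb each other; transposing one absorption identifies them. The same works for
    \<open>X * M\<close> and \<open>Y * M\<close>, and then \<open>Y = Y * M * Y\<close> turns into
    \<open>X\<close>.\<close>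
  have unique: "Y = X" if Y: "?Q Y" for Y
  proof -
    have c: "Y \<in> carrier_mat d d" "X \<in> carrier_mat d d" using Y QX M by auto
    note assoc = assoc_mult_mat[of _ d d _ d _ d]
    have "M * X = (M * Y) * (M * X)" using Y c M by (metis assoc mult_carrier_mat)
    also have "\<dots> = ((M * X) * (M * Y))\<^sup>T"
      using Y QX c M by (simp add: transpose_mult[of "M * X" d d "M * Y" d])
    also have "(M * X) * (M * Y) = M * Y" using QX c M by (metis assoc mult_carrier_mat)
    finally have MX: "M * X = M * Y" using Y by simp
    have "X * M = (X * M) * (Y * M)" using Y c M by (metis assoc mult_carrier_mat)
    also have "\<dots> = ((Y * M) * (X * M))\<^sup>T"
      using Y QX c M by (simp add: transpose_mult[of "Y * M" d d "X * M" d])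
    also have "(Y * M) * (X * M) = Y * M" using QX c M by (metis assoc mult_carrier_mat)
    finally have XM: "X * M = Y * M" using Y by simp
    have "Y = Y * (M * Y)" using Y c M by (metis assoc)
    also have "\<dots> = Y * M * X" unfolding MX[symmetric] using c M by (metis assoc)
    also have "\<dots> = X" unfolding XM[symmetric] using QX by simp
    finally show ?thesis .
  qed
  have "pinv M = X"
    unfolding pinv_def using QX unique by (rule the_equality)
  then show "pinv M \<in> carrier_mat d d" "M * pinv M * M = M" "(M * pinv M)\<^sup>T = M * pinv M"
    using QX M by auto
qed

section \<open>Generalized leverage scores\<close>

definition lev :: "real mat \<Rightarrow> real Matrix.vec \<Rightarrow> real" where
  "lev M a = a \<bullet> (pinv M *\<^sub>v a)"

text \<open>This is M M^+ M = M inside a quadratic form. It is the bridge away from the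
  pseudo-inverse: later arguments pick some solution \<open>y\<close> and never look at
  \<open>pinv\<close> again.\<close>

lemma lev_mult_vec:
  fixes M :: "real mat"
  assumes M: "M \<in> carrier_mat d d" and sym: "M\<^sup>T = M" and y: "y \<in> carrier_vec d"
  shows "lev M (M *\<^sub>v y) = y \<bullet> (M *\<^sub>v y)"
proof -
  note pc = pinv_symmetric[OF M sym]
  define u where "u = pinv M *\<^sub>v (M *\<^sub>v y)"
  have My: "M *\<^sub>v y \<in> carrier_vec d" using M y by simp
  have u: "u \<in> carrier_vec d" unfolding u_def using pc(1) My by simp
  have "lev M (M *\<^sub>v y) = u \<bullet> (M *\<^sub>v y)"
    unfolding lev_def u_def[symmetric] by (rule comm_scalar_prod[OF My u])
  also have "\<dots> = y \<bullet> (M *\<^sub>v u)" by (rule symmetric_scalar_prod_swap[OF M sym u y])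
  also have "M *\<^sub>v u = (M * pinv M * M) *\<^sub>v y"
    unfolding u_def using pc(1) M y by (simp add: assoc_mult_mat_vec[of _ d d _ d])
  finally show ?thesis using pc(2) by simp
qed

text \<open>M M^+ projects orthogonally onto the range of \<open>M\<close>. The residual of
  \<open>a\<close> lies in the kernel, hence is orthogonal to \<open>a\<close> and to the range,
  hence to itself.\<close>

lemma symmetric_range_if_orth_kernel:
  fixes M :: "real mat"
  assumes M: "M \<in> carrier_mat d d" and sym: "M\<^sup>T = M" and a: "a \<in> carrier_vec d"
    and ker: "\<And>x. x \<in> carrier_vec d \<Longrightarrow> M *\<^sub>v x = 0\<^sub>v d \<Longrightarrow> a \<bullet> x = 0"
  shows "\<exists>y \<in> carrier_vec d. M *\<^sub>v y = a"
proof -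
  note pc = pinv_symmetric[OF M sym]
  define y where "y = pinv M *\<^sub>v a"
  have y: "y \<in> carrier_vec d" unfolding y_def using pc(1) a by simp
  have My: "M *\<^sub>v y \<in> carrier_vec d" using M y by simp
  define x where "x = a - M *\<^sub>v y"
  have x: "x \<in> carrier_vec d" unfolding x_def using a My by simp
  have "M * (M * pinv M) = ((M * pinv M)\<^sup>T * M\<^sup>T)\<^sup>T"
    using M pc(1) by (simp add: transpose_mult[of _ d d _ d])
  also have "\<dots> = M" unfolding pc(3) sym pc(2) by simp
  finally have MM: "M * (M * pinv M) = M" .
  have "M *\<^sub>v (M *\<^sub>v y) = (M * (M * pinv M)) *\<^sub>v a"
    unfolding y_def using M pc(1) a by (simp add: assoc_mult_mat_vec[of _ d d _ d])
  then have "M *\<^sub>v x = 0\<^sub>v d"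
    unfolding x_def using M a My by (simp add: MM mult_minus_distrib_mat_vec[of _ d d])
  then have "a \<bullet> x = 0" "(M *\<^sub>v y) \<bullet> x = 0"
    using ker[OF x] symmetric_scalar_prod_swap[OF M sym x y] comm_scalar_prod[OF My x] y by auto
  then have "x \<bullet> x = 0"
    using a My x by (subst (1) x_def) (simp add: minus_scalar_prod_distrib[of _ d])
  then have "x = 0\<^sub>v d" using scalar_prod_self_eq_0_iff[OF x] by simp
  then have "M *\<^sub>v y = a" unfolding x_def using vec_minus_eq_0D[OF a My] by simp
  then show ?thesis using y by blast
qed

subsection \<open>Positive semidefinite matrices\<close>

definition psd :: "nat \<Rightarrow> real mat \<Rightarrow> bool" where
  "psd d M \<longleftrightarrow> M \<in> carrier_mat d d \<and> M\<^sup>T = M \<and> (\<forall>x \<in> carrier_vec d. 0 \<le> x \<bullet> (M *\<^sub>v x))"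

lemma quadratic_nonneg_discriminant:
  fixes a b c :: real
  assumes "\<And>t. 0 \<le> a + 2 * b * t + c * t\<^sup>2"
  shows "b\<^sup>2 \<le> a * c"
proof (cases "c = 0")
  case True
  have "b = 0"
  proof (rule ccontr)
    assume "b \<noteq> 0"
    then show False using assms[of "- (a + 1) / (2 * b)"] True by (simp add: field_simps)
  qed
  then show ?thesis using True by simp
next
  case False
  have "0 \<le> c"
  proof (rule ccontr)
    assume "\<not> 0 \<le> c"
    then have c0: "c < 0" by simp
    have "0 \<le> a" using assms[of 0] by simp
    \<comment> \<open>\<open>r\<close> is so large that the quadratic term cancels a + 1; the sign
      of \<open>t\<close> is then chosen so that the linear term cannot help.\<close>
    define r where "r = sqrt ((a + 1) / (-c))"
    have "0 \<le> (a + 1) / (-c)" using c0 \<open>0 \<le> a\<close> by (intro divide_nonneg_pos) auto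
    then have r: "0 \<le> r" "r\<^sup>2 = (a + 1) / (-c)" by (simp_all add: r_def)
    define t where "t = (if b \<ge> 0 then - r else r)"
    have "t\<^sup>2 = (a + 1) / (-c)" unfolding t_def r(2)[symmetric] by simp
    then have "c * t\<^sup>2 = - (a + 1)" using False by simp
    moreover have "b * t \<le> 0" unfolding t_def using r(1) by (auto simp: mult_le_0_iff)
    ultimately show False using assms[of t] by linarith
  qed
  then have "0 < c" using False by simp
  \<comment> \<open>The minimizer of the parabola.\<close>
  then show ?thesis using assms[of "- b / c"] by (simp add: field_simps power2_eq_square)
qed

text \<open>Along the line y + t x the form is a nonnegative quadratic polynomial in
  \<open>t\<close>.\<close>

lemma psd_cauchy_schwarz:
  assumes "psd d M" and x: "x \<in> carrier_vec d" and y: "y \<in> carrier_vec d"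
  shows "(y \<bullet> (M *\<^sub>v x))\<^sup>2 \<le> (y \<bullet> (M *\<^sub>v y)) * (x \<bullet> (M *\<^sub>v x))"
proof -
  have M: "M \<in> carrier_mat d d" "M\<^sup>T = M" using assms(1) by (auto simp: psd_def)
  have "0 \<le> (y \<bullet> (M *\<^sub>v y)) + 2 * (y \<bullet> (M *\<^sub>v x)) * t + (x \<bullet> (M *\<^sub>v x)) * t\<^sup>2" for t
  proof -
    have c: "M *\<^sub>v x \<in> carrier_vec d" "M *\<^sub>v y \<in> carrier_vec d" using M x y by auto
    have "0 \<le> (y + t \<cdot>\<^sub>v x) \<bullet> (M *\<^sub>v (y + t \<cdot>\<^sub>v x))"
      using assms(1) x y by (simp add: psd_def)
    also have "M *\<^sub>v (y + t \<cdot>\<^sub>v x) = M *\<^sub>v y + t \<cdot>\<^sub>v (M *\<^sub>v x)"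
      using M x y by (simp add: mult_add_distrib_mat_vec[of _ d d] mult_mat_vec[of _ d d])
    also have "(y + t \<cdot>\<^sub>v x) \<bullet> (M *\<^sub>v y + t \<cdot>\<^sub>v (M *\<^sub>v x))
        = y \<bullet> (M *\<^sub>v y) + t * (y \<bullet> (M *\<^sub>v x)) + t * (x \<bullet> (M *\<^sub>v y)) + t * t * (x \<bullet> (M *\<^sub>v x))"
      using x y c by (simp add: add_scalar_prod_distrib[of _ d] scalar_prod_add_distrib[of _ d] algebra_simps)
    finally show ?thesis
      using symmetric_scalar_prod_swap[OF M x y] by (simp add: power2_eq_square algebra_simps)
  qed
  then show ?thesis by (rule quadratic_nonneg_discriminant)
qed

text \<open>Cauchy-Schwarz with the test vector M x bounds the squared norm of M x by zero.\<close>

lemma psd_quadratic_form_eq_0: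
  assumes "psd d M" and x: "x \<in> carrier_vec d" and "x \<bullet> (M *\<^sub>v x) = 0"
  shows "M *\<^sub>v x = 0\<^sub>v d"
proof -
  have y: "M *\<^sub>v x \<in> carrier_vec d" using assms(1) x by (auto simp: psd_def)
  have "((M *\<^sub>v x) \<bullet> (M *\<^sub>v x))\<^sup>2 \<le> 0"
    using psd_cauchy_schwarz[OF assms(1) x y] assms(3) by simp
  then show ?thesis using scalar_prod_self_eq_0_iff[OF y] by simp
qed

text \<open>The main comparison device: equality holds at x = y, so scores of two matrices are
  compared by testing the solution that belongs to one of them in the quadratic form of the
  other.\<close>

lemma lev_cauchy_schwarz:
  assumes M: "psd d M" and x: "x \<in> carrier_vec d" and y: "y \<in> carrier_vec d" and a: "M *\<^sub>v y = a"
  shows "(a \<bullet> x)\<^sup>2 \<le> lev M a * (x \<bullet> (M *\<^sub>v x))"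
proof -
  have M': "M \<in> carrier_mat d d" "M\<^sup>T = M" using M by (auto simp: psd_def)
  have "a \<bullet> x = y \<bullet> (M *\<^sub>v x)"
    using symmetric_scalar_prod_swap[OF M' x y] a comm_scalar_prod[of a d x] M' x y by auto
  then show ?thesis using psd_cauchy_schwarz[OF M x y] lev_mult_vec[OF M' y] a by simp
qed

lemma lev_eq_scalar_prod:
  assumes M: "psd d M" and y: "y \<in> carrier_vec d" and a: "M *\<^sub>v y = a"
  shows "lev M a = a \<bullet> y"
proof -
  have "y \<bullet> a = a \<bullet> y"
    using M y a comm_scalar_prod[of a d y] by (auto simp: psd_def)
  then show ?thesis using lev_mult_vec[of M d y] M y unfolding psd_def a[symmetric] by simp
qed

lemma lev_nonneg:
  assumes "psd d M" "y \<in> carrier_vec d" "M *\<^sub>v y = a"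
  shows "0 \<le> lev M a"
  using lev_mult_vec[of M d y] assms(1,2) unfolding psd_def assms(3)[symmetric] by simp

lemma lev_pos:
  assumes "psd d M" "y \<in> carrier_vec d" "M *\<^sub>v y = a" "a \<noteq> 0\<^sub>v d"
  shows "0 < lev M a"
proof -
  have "y \<bullet> (M *\<^sub>v y) \<noteq> 0"
  proof
    assume "y \<bullet> (M *\<^sub>v y) = 0"
    from psd_quadratic_form_eq_0[OF assms(1,2) this] show False using assms(3,4) by simp
  qed
  moreover have "lev M a = y \<bullet> (M *\<^sub>v y)"
    using lev_mult_vec[of M d y] assms(1,2) unfolding psd_def assms(3)[symmetric] by simp
  ultimately show ?thesis using lev_nonneg[OF assms(1-3)] by linarith
qed

text \<open>Domination of the square makes \<open>a\<close> orthogonal to the kernel. This yields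
  solvability for singular matrices that contain \<open>outer a\<close> as a summand.\<close>

lemma range_if_square_le_quadratic_form:
  assumes M: "psd d M" and a: "a \<in> carrier_vec d"
    and le: "\<And>x. x \<in> carrier_vec d \<Longrightarrow> (a \<bullet> x)\<^sup>2 \<le> C * (x \<bullet> (M *\<^sub>v x))"
  shows "\<exists>y \<in> carrier_vec d. M *\<^sub>v y = a"
proof (rule symmetric_range_if_orth_kernel)
  fix x assume "x \<in> carrier_vec d" "M *\<^sub>v x = 0\<^sub>v d"
  then show "a \<bullet> x = 0" using le[of x] by simp
qed (use M a in \<open>auto simp: psd_def\<close>)

definition pd :: "nat \<Rightarrow> real mat \<Rightarrow> bool" where
  "pd d M \<longleftrightarrow> psd d M \<and> (\<forall>x \<in> carrier_vec d. x \<noteq> 0\<^sub>v d \<longrightarrow> 0 < x \<bullet> (M *\<^sub>v x))"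

lemma pd_solve:
  assumes M: "pd d M" and a: "a \<in> carrier_vec d"
  obtains y where "y \<in> carrier_vec d" "M *\<^sub>v y = a"
proof -
  have "\<exists>y \<in> carrier_vec d. M *\<^sub>v y = a"
  proof (rule symmetric_range_if_orth_kernel)
    fix x assume x: "x \<in> carrier_vec d" "M *\<^sub>v x = 0\<^sub>v d"
    then have "x = 0\<^sub>v d" using M unfolding pd_def by force
    then show "a \<bullet> x = 0" using a by simp
  qed (use M a in \<open>auto simp: psd_def pd_def\<close>)
  then show ?thesis using that by blast
qed

subsection \<open>Rank-one updates and Gram matrices\<close>

lemma outer_carrier [simp]: "a \<in> carrier_vec d \<Longrightarrow> outer a \<in> carrier_mat d d"
  by (auto simp: outer_def)

lemma outer_transpose [simp]: "(outer a)\<^sup>T = outer a"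
  by (rule eq_matI) (auto simp: outer_def)

lemma outer_mult_vec:
  assumes "a \<in> carrier_vec d" "x \<in> carrier_vec d"
  shows "outer a *\<^sub>v x = (a \<bullet> x) \<cdot>\<^sub>v a"
  using assms by (intro eq_vecI) (auto simp: outer_def scalar_prod_def sum_distrib_left sum_distrib_right mult_ac)

lemma outer_quadratic_form:
  assumes "a \<in> carrier_vec d" "x \<in> carrier_vec d"
  shows "x \<bullet> (outer a *\<^sub>v x) = (a \<bullet> x)\<^sup>2"
  using assms comm_scalar_prod[OF assms] by (simp add: outer_mult_vec[OF assms] power2_eq_square)

lemma quadratic_form_add:
  fixes A :: "real mat"
  assumes "A \<in> carrier_mat d d" "B \<in> carrier_mat d d" "x \<in> carrier_vec d"
  shows "x \<bullet> ((A + B) *\<^sub>v x) = x \<bullet> (A *\<^sub>v x) + x \<bullet> (B *\<^sub>v x)"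
  using assms by (simp add: add_mult_distrib_mat_vec[of _ d d] scalar_prod_add_distrib[of _ d])

lemma quadratic_form_smult:
  fixes A :: "real mat"
  assumes "A \<in> carrier_mat d d" "x \<in> carrier_vec d"
  shows "x \<bullet> ((c \<cdot>\<^sub>m A) *\<^sub>v x) = c * (x \<bullet> (A *\<^sub>v x))"
  using assms by (simp add: smult_mat_mult_vec[of _ d d])

lemma quadratic_form_minus:
  fixes A :: "real mat"
  assumes "A \<in> carrier_mat d d" "B \<in> carrier_mat d d" "x \<in> carrier_vec d"
  shows "x \<bullet> ((A - B) *\<^sub>v x) = x \<bullet> (A *\<^sub>v x) - x \<bullet> (B *\<^sub>v x)"
  using assms by (simp add: minus_mult_distrib_mat_vec[of _ d d] scalar_prod_minus_distrib[of _ d])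

lemma gram_carrier [simp]: "gram d rs \<in> carrier_mat d d"
  by (simp add: gram_def mult_carrier_mat[of _ d "length rs" _ d])

lemma gram_dim [simp]: "dim_row (gram d rs) = d" "dim_col (gram d rs) = d"
  using gram_carrier[of d rs] by blast+

lemma gram_index:
  assumes "i < d" "j < d" "set rs \<subseteq> carrier_vec d"
  shows "gram d rs $$ (i, j) = (\<Sum>r\<leftarrow>rs. r $ i * r $ j)"
proof -
  have "gram d rs $$ (i, j) = (\<Sum>k<length rs. rs ! k $ i * rs ! k $ j)"
    using assms by (auto simp: gram_def scalar_prod_def mat_of_rows_index atLeast0LessThan intro!: sum.cong)
  then show ?thesis by (simp add: sum_list_sum_nth atLeast0LessThan)
qed

lemma gram_Nil: "gram d [] = 0\<^sub>m d d"
  by (rule eq_matI) (auto simp: gram_index)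

lemma gram_snoc:
  assumes "set rs \<subseteq> carrier_vec d" "r \<in> carrier_vec d"
  shows "gram d (rs @ [r]) = gram d rs + outer r"
  using assms by (intro eq_matI) (auto simp: gram_index outer_def)

lemma gram_transpose [simp]: "(gram d rs)\<^sup>T = gram d rs"
  by (simp add: gram_def transpose_mult[of _ d "length rs" _ d])

lemma gram_quadratic_form:
  assumes "set rs \<subseteq> carrier_vec d" "x \<in> carrier_vec d"
  shows "x \<bullet> (gram d rs *\<^sub>v x) = (\<Sum>r\<leftarrow>rs. (r \<bullet> x)\<^sup>2)"
  using assms(1)
proof (induction rs rule: rev_induct)
  case Nil
  have "0\<^sub>m d d *\<^sub>v x = 0\<^sub>v d" using assms(2) by (intro eq_vecI) auto
  then show ?case using assms(2) by (simp add: gram_Nil)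
next
  case (snoc r rs)
  then show ?case
    using assms(2) by (simp add: gram_snoc quadratic_form_add[of _ d] outer_quadratic_form[of _ d])
qed

lemma gram_psd:
  assumes "set rs \<subseteq> carrier_vec d"
  shows "psd d (gram d rs)"
  using assms by (auto simp: psd_def gram_quadratic_form intro!: sum_list_nonneg)

text \<open>Sherman-Morrison stated for scores, with an explicit solution of the updated system in
  place of an inverse. A negative \<open>s\<close> keeps definiteness because Cauchy-Schwarz bounds
  the loss by the fraction -s * \<open>lev Y a\<close> < 1 of the form of \<open>Y\<close>.\<close>

lemma lev_rank_one_update:
  assumes Y: "pd d Y" and a: "a \<in> carrier_vec d" and s: "0 < 1 + s * lev Y a"
  shows "pd d (Y + s \<cdot>\<^sub>m outer a)"
    and "\<lbrakk>z \<in> carrier_vec d; Y *\<^sub>v z = x\<rbrakk> \<Longrightarrow>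
      lev (Y + s \<cdot>\<^sub>m outer a) x = lev Y x - (a \<bullet> z)\<^sup>2 * (s / (1 + s * lev Y a))"
proof -
  have Yp: "psd d Y" and Yc: "Y \<in> carrier_mat d d" "Y\<^sup>T = Y" using Y by (auto simp: pd_def psd_def)
  let ?Z = "Y + s \<cdot>\<^sub>m outer a"
  have oa: "outer a \<in> carrier_mat d d" using a by simp
  have Zc: "?Z \<in> carrier_mat d d" using Yc a by simp
  have "(s \<cdot>\<^sub>m outer a)\<^sup>T = s \<cdot>\<^sub>m outer a"
    using a by (intro eq_matI) (auto simp: outer_def)
  then have Zs: "?Z\<^sup>T = ?Z" using Yc oa by (simp add: transpose_add[of _ d d])
  obtain w where w: "w \<in> carrier_vec d" "Y *\<^sub>v w = a" using pd_solve[OF Y a] .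
  have q: "x \<bullet> (?Z *\<^sub>v x) = x \<bullet> (Y *\<^sub>v x) + s * (a \<bullet> x)\<^sup>2" if "x \<in> carrier_vec d" for x
    using that a Yc oa
    by (simp add: quadratic_form_add[of _ d] quadratic_form_smult[of _ d] outer_quadratic_form[of _ d])
  have pos: "0 < x \<bullet> (?Z *\<^sub>v x)" if x: "x \<in> carrier_vec d" "x \<noteq> 0\<^sub>v d" for x
  proof -
    have Yx: "0 < x \<bullet> (Y *\<^sub>v x)" using Y x by (auto simp: pd_def)
    show ?thesis
    proof (cases "s \<ge> 0")
      case True then show ?thesis using q[OF x(1)] Yx by (simp add: add_pos_nonneg)
    next
      case False
      have "s * (lev Y a * (x \<bullet> (Y *\<^sub>v x))) \<le> s * (a \<bullet> x)\<^sup>2"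
        using lev_cauchy_schwarz[OF Yp x(1) w] False by (intro mult_left_mono_neg) auto
      moreover have "0 < (1 + s * lev Y a) * (x \<bullet> (Y *\<^sub>v x))" using s Yx by simp
      ultimately show ?thesis using q[OF x(1)] by (simp add: algebra_simps)
    qed
  qed
  have "0 \<le> x \<bullet> (?Z *\<^sub>v x)" if x: "x \<in> carrier_vec d" for x
    using pos[OF x] x Zc by (cases "x = 0\<^sub>v d") auto
  then show pdZ: "pd d ?Z" using pos Zc Zs by (auto simp: pd_def psd_def)
  assume z: "z \<in> carrier_vec d" "Y *\<^sub>v z = x"
  \<comment> \<open>Applying \<open>?Z\<close> to z - k w gives x - k a + s (a . z') a; this
    \<open>k\<close> solves s (a . z') = k, so that the two multiples of \<open>a\<close>
    cancel.\<close>
  define k where "k = s * (a \<bullet> z) / (1 + s * lev Y a)"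
  define z' where "z' = z - k \<cdot>\<^sub>v w"
  have z': "z' \<in> carrier_vec d" using z w by (simp add: z'_def)
  have xc: "x \<in> carrier_vec d" using z Yc by auto
  have tau: "lev Y a = a \<bullet> w" using lev_eq_scalar_prod[OF Yp w] .
  have kk: "s * (a \<bullet> z) - s * k * (a \<bullet> w) = k"
    using s by (simp add: k_def tau field_simps)
  have soz: "(s \<cdot>\<^sub>m outer a) *\<^sub>v z' = (s * (a \<bullet> z')) \<cdot>\<^sub>v a"
    using oa z' a by (simp add: smult_mat_mult_vec[of _ d d] outer_mult_vec[of _ d] smult_smult_assoc)
  have "?Z *\<^sub>v z' = Y *\<^sub>v z' + (s * (a \<bullet> z')) \<cdot>\<^sub>v a"
    using Yc oa z' by (simp add: add_mult_distrib_mat_vec[of _ d d] soz)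
  also have "Y *\<^sub>v z' = x - k \<cdot>\<^sub>v a"
    unfolding z'_def using Yc z w by (simp add: mult_minus_distrib_mat_vec[of _ d d] mult_mat_vec[of _ d d])
  also have "s * (a \<bullet> z') = k"
    unfolding z'_def using a z w kk by (simp add: scalar_prod_minus_distrib[of _ d] algebra_simps)
  finally have Zz: "?Z *\<^sub>v z' = x" using xc a by (auto simp: vec_eq_iff)
  have "x \<bullet> w = a \<bullet> z"
    using symmetric_scalar_prod_swap[OF Yc z(1) w(1)] z w comm_scalar_prod[of a d z] a
      comm_scalar_prod[of x d w] xc by simp
  then have "x \<bullet> z' = x \<bullet> z - k * (a \<bullet> z)"
    unfolding z'_def using xc z w by (simp add: scalar_prod_minus_distrib[of _ d])
  then show "lev ?Z x = lev Y x - (a \<bullet> z)\<^sup>2 * (s / (1 + s * lev Y a))"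
    using lev_eq_scalar_prod[OF _ z' Zz] pdZ lev_eq_scalar_prod[OF Yp z]
    by (simp add: pd_def k_def power2_eq_square)
qed

text \<open>The matrix determinant lemma, from two block-triangular factorizations of the bordered
  matrix with rows (1, -a^T) and (a, M). Stating it with a solution \<open>w\<close> avoids an
  inverse of \<open>M\<close>.\<close>

lemma det_add_outer:
  fixes M :: "real mat"
  assumes M: "M \<in> carrier_mat d d" and a: "a \<in> carrier_vec d" and w: "w \<in> carrier_vec d"
    and Mw: "M *\<^sub>v w = a"
  shows "Determinant.det (M + outer a) = Determinant.det M * (1 + a \<bullet> w)"
proof -
  define U where "U = mat_of_cols d [a]"
  define V where "V = mat_of_rows d [- a]"
  define W where "W = mat_of_cols d [w]"
  define c where "c = Matrix.mat 1 1 (\<lambda>_. 1 + a \<bullet> w)"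
  have carr: "U \<in> carrier_mat d 1" "V \<in> carrier_mat 1 d" "W \<in> carrier_mat d 1"
    "c \<in> carrier_mat 1 1" "M + outer a \<in> carrier_mat d d"
    using M a by (auto simp: U_def V_def W_def c_def)
  have UV: "U * V + (M + outer a) = M"
    using M a by (intro eq_matI) (auto simp: U_def V_def outer_def scalar_prod_def mat_of_rows_index mat_of_cols_index)
  have MW: "M * W = U"
  proof (rule eq_matI)
    fix i j assume "i < dim_row U" "j < dim_col U"
    then have "i < d" "j = 0" using carr by auto
    then show "(M * W) $$ (i,j) = U $$ (i,j)"
      using M w a arg_cong[OF Mw, of "\<lambda>v. v $ i"] by (simp add: W_def U_def mat_of_cols_index)
  qed (use M carr in auto)
  have VW: "c + V * W = 1\<^sub>m 1"
    using a w by (intro eq_matI)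
      (auto simp: c_def V_def W_def scalar_prod_def mat_of_rows_index mat_of_cols_index sum_negf)
  have "four_block_mat (1\<^sub>m 1) (0\<^sub>m 1 d) U (1\<^sub>m d) * four_block_mat (1\<^sub>m 1) V (0\<^sub>m d 1) (M + outer a)
      = four_block_mat (1\<^sub>m 1) V U M"
    using carr M UV left_mult_zero_mat[OF carr(5)] left_mult_one_mat[OF carr(5)] by (subst mult_four_block_mat[of _ 1 1 _ d _ d _ _ 1 _ d]) (simp_all del: One_nat_def)
  also have "\<dots> = four_block_mat c V (0\<^sub>m d 1) M * four_block_mat (1\<^sub>m 1) (0\<^sub>m 1 d) W (1\<^sub>m d)"
    using carr M VW MW by (subst mult_four_block_mat[of _ 1 1 _ d _ d _ _ 1 _ d]) (simp_all del: One_nat_def)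
  finally have eq: "Determinant.det (four_block_mat (1\<^sub>m 1) (0\<^sub>m 1 d) U (1\<^sub>m d) * four_block_mat (1\<^sub>m 1) V (0\<^sub>m d 1) (M + outer a))
      = Determinant.det (four_block_mat c V (0\<^sub>m d 1) M * four_block_mat (1\<^sub>m 1) (0\<^sub>m 1 d) W (1\<^sub>m d))"
    by simp
  have fc: "four_block_mat (1\<^sub>m 1) (0\<^sub>m 1 d) U (1\<^sub>m d) \<in> carrier_mat (1 + d) (1 + d)"
    "four_block_mat (1\<^sub>m 1) V (0\<^sub>m d 1) (M + outer a) \<in> carrier_mat (1 + d) (1 + d)"
    "four_block_mat c V (0\<^sub>m d 1) M \<in> carrier_mat (1 + d) (1 + d)"
    "four_block_mat (1\<^sub>m 1) (0\<^sub>m 1 d) W (1\<^sub>m d) \<in> carrier_mat (1 + d) (1 + d)"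
    using carr M by (auto intro!: four_block_carrier_mat simp del: One_nat_def)
  have "Determinant.det (four_block_mat (1\<^sub>m 1) (0\<^sub>m 1 d) U (1\<^sub>m d)) = 1"
    "Determinant.det (four_block_mat (1\<^sub>m 1) (0\<^sub>m 1 d) W (1\<^sub>m d)) = 1"
    "Determinant.det (four_block_mat (1\<^sub>m 1) V (0\<^sub>m d 1) (M + outer a)) = Determinant.det (M + outer a)"
    "Determinant.det (four_block_mat c V (0\<^sub>m d 1) M) = Determinant.det c * Determinant.det M"
    using carr M
    by (simp_all add: det_four_block_mat_upper_right_zero[of _ 1 _ d] det_four_block_mat_lower_left_zero[of _ 1 _ d]
        del: One_nat_def)
  moreover have "Determinant.det c = 1 + a \<bullet> w"
    by (simp add: c_def Determinant.det_def sign_def)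
  ultimately show ?thesis
    using eq unfolding Determinant.det_mult[OF fc(1,2)] Determinant.det_mult[OF fc(3,4)] by simp
qed

lemma gram_rows:
  assumes "A \<in> carrier_mat n d"
  shows "gram d (Matrix.rows A) = A\<^sup>T * A"
  using assms by (metis carrier_matD(2) gram_def mat_of_rows_rows)

lemma rows_carrier:
  assumes "A \<in> carrier_mat n d"
  shows "set (Matrix.rows A) \<subseteq> carrier_vec d"
  using assms by (auto simp: Matrix.rows_def)

subsection \<open>Spectra of Gram matrices\<close>

text \<open>The columns of \<open>P\<close> are right singular vectors of \<open>B\<close>, and
  \<open>f\<close> lists its squared singular values with multiplicity. The locale translates
  between \<open>spec_norm\<close> and \<open>sigma_min\<close>, which are defined through
  eigenvalues, and quadratic forms, which need coordinates. It is instantiated for the whole matrix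
  and for its prefixes.\<close>

locale gram_diagonalization =
  fixes n d :: nat and B P :: "real mat" and f :: "nat \<Rightarrow> real"
  assumes B: "B \<in> carrier_mat n d" and P: "P \<in> carrier_mat d d" and PTP: "P\<^sup>T * P = 1\<^sub>m d"
    and diag: "B\<^sup>T * B = P * mat_diag d f * P\<^sup>T"
begin

abbreviation "G \<equiv> B\<^sup>T * B"

lemma G_carrier: "G \<in> carrier_mat d d"
  using B by (simp add: mult_carrier_mat[of _ d n _ d])

lemma PT: "P\<^sup>T \<in> carrier_mat d d"
  using P by simp

lemma PPT: "P * P\<^sup>T = 1\<^sub>m d"
  using mat_mult_left_right_inverse[OF PT P PTP] .

lemma mat_diag_mult_vec: "c \<in> carrier_vec d \<Longrightarrow> mat_diag d f *\<^sub>v c = Matrix.vec d (\<lambda>i. f i * c $ i)"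
proof (rule eq_vecI)
  fix i assume c: "c \<in> carrier_vec d" and "i < dim_vec (Matrix.vec d (\<lambda>i. f i * c $ i))"
  then have i: "i < d" by simp
  have "(mat_diag d f *\<^sub>v c) $ i = (\<Sum>j\<in>{0..<d}. (if i = j then f j else 0) * c $ j)"
    using i c by (simp add: mat_diag_def scalar_prod_def)
  also have "\<dots> = (\<Sum>j\<in>{0..<d}. if i = j then f j * c $ j else 0)"
    by (rule sum.cong) auto
  also have "\<dots> = f i * c $ i" using i by simp
  finally show "(mat_diag d f *\<^sub>v c) $ i = Matrix.vec d (\<lambda>i. f i * c $ i) $ i" using i by simp
qed (auto simp: mat_diag_def)

lemma coords_carrier: "x \<in> carrier_vec d \<Longrightarrow> P\<^sup>T *\<^sub>v x \<in> carrier_vec d"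
  using PT by simp

lemma G_mult_vec:
  assumes x: "x \<in> carrier_vec d"
  shows "G *\<^sub>v x = P *\<^sub>v Matrix.vec d (\<lambda>i. f i * (P\<^sup>T *\<^sub>v x) $ i)"
proof -
  have "G *\<^sub>v x = P *\<^sub>v (mat_diag d f *\<^sub>v (P\<^sup>T *\<^sub>v x))"
    unfolding diag using P PT x
    by (simp add: assoc_mult_mat_vec[of _ d d _ d] mult_carrier_mat[of _ d d _ d])
  then show ?thesis using mat_diag_mult_vec[OF coords_carrier[OF x]] by simp
qed

lemma scalar_prod_coords:
  assumes x: "x \<in> carrier_vec d" and c: "c \<in> carrier_vec d"
  shows "x \<bullet> (P *\<^sub>v c) = (\<Sum>i<d. (P\<^sup>T *\<^sub>v x) $ i * c $ i)"
proof -
  have "x \<bullet> (P *\<^sub>v c) = (P\<^sup>T *\<^sub>v x) \<bullet> c"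
    using transpose_vec_mult_scalar[OF P c x] by simp
  then show ?thesis using c by (simp add: scalar_prod_def atLeast0LessThan)
qed

lemma quadratic_form_coords:
  assumes x: "x \<in> carrier_vec d"
  shows "x \<bullet> (G *\<^sub>v x) = (\<Sum>i<d. f i * ((P\<^sup>T *\<^sub>v x) $ i)\<^sup>2)"
  unfolding G_mult_vec[OF x] by (subst scalar_prod_coords[OF x]) (auto simp: power2_eq_square mult_ac)

lemma norm_coords:
  assumes x: "x \<in> carrier_vec d"
  shows "x \<bullet> x = (\<Sum>i<d. ((P\<^sup>T *\<^sub>v x) $ i)\<^sup>2)"
proof -
  have "x = P *\<^sub>v (P\<^sup>T *\<^sub>v x)" using P PT x PPT by (simp add: assoc_mult_mat_vec[of _ d d _ d, symmetric])
  then show ?thesis using scalar_prod_coords[OF x coords_carrier[OF x]] by (simp add: power2_eq_square)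
qed

lemma rayleigh_upper:
  assumes x: "x \<in> carrier_vec d" and S: "\<And>k. k < d \<Longrightarrow> f k \<le> S"
  shows "x \<bullet> (G *\<^sub>v x) \<le> S * (x \<bullet> x)"
  unfolding quadratic_form_coords[OF x] norm_coords[OF x] sum_distrib_left
  using S by (intro sum_mono mult_right_mono) auto

text \<open>Vectors in the range of the Gram matrix have zero coordinates wherever \<open>f\<close>
  vanishes, so only nonzero eigenvalues contribute.\<close>

lemma rayleigh_lower_on_range:
  assumes y: "y \<in> carrier_vec d" and m: "\<And>k. k < d \<Longrightarrow> f k \<noteq> 0 \<Longrightarrow> m \<le> f k"
  shows "m * ((G *\<^sub>v y) \<bullet> (G *\<^sub>v y)) \<le> (G *\<^sub>v y) \<bullet> (G *\<^sub>v (G *\<^sub>v y))"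
proof -
  define x where "x = G *\<^sub>v y"
  have x: "x \<in> carrier_vec d" unfolding x_def using G_carrier y by simp
  have "P\<^sup>T *\<^sub>v x = (P\<^sup>T * P) *\<^sub>v Matrix.vec d (\<lambda>i. f i * (P\<^sup>T *\<^sub>v y) $ i)"
    unfolding x_def G_mult_vec[OF y] using P PT by (simp add: assoc_mult_mat_vec[of _ d d _ d])
  then have c: "(P\<^sup>T *\<^sub>v x) $ i = f i * (P\<^sup>T *\<^sub>v y) $ i" if "i < d" for i
    using that by (simp add: PTP)
  have "m * ((P\<^sup>T *\<^sub>v x) $ i)\<^sup>2 \<le> f i * ((P\<^sup>T *\<^sub>v x) $ i)\<^sup>2" if "i < d" for i
    using m[OF that] c[OF that] by (cases "f i = 0") (auto intro: mult_right_mono)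
  then show ?thesis
    unfolding x_def[symmetric] quadratic_form_coords[OF x] norm_coords[OF x] sum_distrib_left
    by (intro sum_mono) auto
qed

lemma G_col:
  assumes k: "k < d"
  shows "G *\<^sub>v col P k = f k \<cdot>\<^sub>v col P k"
proof -
  have "col (G * P) k = col (P * mat_diag d f) k"
  proof -
    have "G * P = P * mat_diag d f * (P\<^sup>T * P)"
      unfolding diag using P PT by (simp add: assoc_mult_mat[of _ d d _ d _ d] mult_carrier_mat[of _ d d _ d])
    then show ?thesis unfolding PTP using right_mult_one_mat[of "P * mat_diag d f" d d] P by simp
  qed
  also have "\<dots> = f k \<cdot>\<^sub>v col P k"
    using P k by (intro eq_vecI) (auto simp: mat_diag_mult_right)
  finally show ?thesis unfolding col_mult2[OF G_carrier P k] .
qed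

lemma col_P_orthonormal:
  assumes "j < d" "k < d"
  shows "col P j \<bullet> col P k = (if j = k then 1 else 0)"
  using arg_cong[OF PTP, of "\<lambda>M. M $$ (j,k)"] assms P by simp

lemma eigenvalue_f:
  assumes k: "k < d"
  shows "eigenvalue G (f k)"
proof -
  have "col P k \<noteq> 0\<^sub>v d" using col_P_orthonormal[OF k k] by auto
  then show ?thesis
    unfolding eigenvalue_def eigenvector_def
    by (intro exI[of _ "col P k"]) (use G_col[OF k] P k G_carrier in auto)
qed

lemma eigenvalue_nonneg:
  assumes "eigenvalue G l"
  shows "0 \<le> l"
proof -
  obtain v where v: "v \<in> carrier_vec d" "v \<noteq> 0\<^sub>v d" "G *\<^sub>v v = l \<cdot>\<^sub>v v"
    using assms G_carrier by (auto simp: eigenvalue_def eigenvector_def)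
  have "l * (v \<bullet> v) = v \<bullet> (G *\<^sub>v v)" using v by simp
  also have "\<dots> = (B *\<^sub>v v) \<bullet> (B *\<^sub>v v)"
  proof -
    have "v \<bullet> (G *\<^sub>v v) = v \<bullet> (B\<^sup>T *\<^sub>v (B *\<^sub>v v))"
      using B v by (simp add: assoc_mult_mat_vec[of _ d n _ d])
    also have "\<dots> = (B\<^sup>T *\<^sub>v (B *\<^sub>v v)) \<bullet> v"
      using B v by (intro comm_scalar_prod[of _ d]) auto
    finally show ?thesis using transpose_vec_mult_scalar[OF B v(1), of "B *\<^sub>v v"] B v by simp
  qed
  finally have "0 \<le> l * (v \<bullet> v)" using scalar_prod_self_nonneg by simp
  then show ?thesis using scalar_prod_self_pos[OF v(1,2)] by (simp add: zero_le_mult_iff)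
qed

lemma finite_singular_values: "finite (singular_values B)"
proof -
  have "finite {l. eigenvalue G l}"
    using card_finite_spectrum(1)[OF G_carrier] by (simp add: spectrum_def)
  then show ?thesis unfolding singular_values_def
    unfolding setcompr_eq_image by (rule finite_imageI)
qed

lemma singular_value_f: "k < d \<Longrightarrow> sqrt (f k) \<in> singular_values B"
  using eigenvalue_f by (auto simp: singular_values_def)

lemma f_nonneg: "k < d \<Longrightarrow> 0 \<le> f k"
  using eigenvalue_f eigenvalue_nonneg by blast

lemma f_le_spec_norm:
  assumes k: "k < d"
  shows "f k \<le> (spec_norm B)\<^sup>2"
proof -
  have "sqrt (f k) \<le> spec_norm B"
    using singular_value_f[OF k] finite_singular_values by (auto simp: spec_norm_def)
  then have "(sqrt (f k))\<^sup>2 \<le> (spec_norm B)\<^sup>2"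
    using f_nonneg[OF k] by (intro power_mono) auto
  then show ?thesis using f_nonneg[OF k] by simp
qed

lemma sigma_min_le_f:
  assumes k: "k < d" and "f k \<noteq> 0"
  shows "(sigma_min B)\<^sup>2 \<le> f k"
proof -
  have mem: "sqrt (f k) \<in> singular_values B - {0}" using singular_value_f[OF k] assms(2) by simp
  have fin: "finite (singular_values B - {0})" using finite_singular_values by simp
  have "sigma_min B \<in> singular_values B - {0}"
    unfolding sigma_min_def using mem fin by (intro Min_in) auto
  then have "0 \<le> sigma_min B" using eigenvalue_nonneg by (auto simp: singular_values_def)
  moreover have "sigma_min B \<le> sqrt (f k)" unfolding sigma_min_def using mem fin by simp
  ultimately have "(sigma_min B)\<^sup>2 \<le> (sqrt (f k))\<^sup>2" by (intro power_mono) auto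
  then show ?thesis using f_nonneg[OF k] by simp
qed

text \<open>A nonzero matrix has a nonzero eigenvalue in its Gram matrix, since otherwise |B v|^2
  would vanish for all \<open>v\<close>; hence the minimum in \<open>sigma_min\<close> ranges over a
  nonempty finite set and is attained.\<close>

lemma sigma_min_attained:
  assumes "B \<noteq> 0\<^sub>m n d"
  shows "\<exists>v \<in> carrier_vec d. v \<noteq> 0\<^sub>v d \<and> v \<bullet> (G *\<^sub>v v) = (sigma_min B)\<^sup>2 * (v \<bullet> v)" "0 < (sigma_min B)\<^sup>2"
proof -
  have "\<exists>k<d. f k \<noteq> 0"
  proof (rule ccontr)
    assume "\<not> (\<exists>k<d. f k \<noteq> 0)"
    then have "v \<bullet> (G *\<^sub>v v) = 0" if "v \<in> carrier_vec d" for v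
      unfolding quadratic_form_coords[OF that] by simp
    then have Bv: "B *\<^sub>v v = 0\<^sub>v n" if v: "v \<in> carrier_vec d" for v
    proof -
      have Bv: "B *\<^sub>v v \<in> carrier_vec n" using B v by simp
      have "v \<bullet> (G *\<^sub>v v) = v \<bullet> (B\<^sup>T *\<^sub>v (B *\<^sub>v v))"
        using B v by (simp add: assoc_mult_mat_vec[of _ d n _ d])
      also have "\<dots> = (B\<^sup>T *\<^sub>v (B *\<^sub>v v)) \<bullet> v"
        using B v by (intro comm_scalar_prod[of _ d]) auto
      also have "\<dots> = (B *\<^sub>v v) \<bullet> (B *\<^sub>v v)"
        using transpose_vec_mult_scalar[OF B v Bv] .
      finally show ?thesis
        using \<open>\<And>v. v \<in> carrier_vec d \<Longrightarrow> v \<bullet> (G *\<^sub>v v) = 0\<close>[OF v] scalar_prod_self_eq_0_iff[OF Bv] by simp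
    qed
    have "B = 0\<^sub>m n d"
    proof (rule eq_matI)
      fix i j assume ij: "i < dim_row (0\<^sub>m n d :: real mat)" "j < dim_col (0\<^sub>m n d :: real mat)"
      then have "(B *\<^sub>v unit_vec d j) $ i = 0" using Bv[of "unit_vec d j"] by simp
      then show "B $$ (i,j) = (0\<^sub>m n d :: real mat) $$ (i,j)" using ij B by simp
    qed (use B in auto)
    then show False using assms by simp
  qed
  then obtain k where "k < d" "f k \<noteq> 0" by blast
  then have "singular_values B - {0} \<noteq> {}" using singular_value_f[of k] by auto
  then have "sigma_min B \<in> singular_values B - {0}"
    unfolding sigma_min_def using finite_singular_values by (intro Min_in) auto
  then obtain l where l: "sigma_min B = sqrt l" "eigenvalue G l" "sqrt l \<noteq> 0"
    by (auto simp: singular_values_def)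
  then have "0 \<le> l" using eigenvalue_nonneg by blast
  then have "(sigma_min B)\<^sup>2 = l" using l by simp
  moreover obtain v where "v \<in> carrier_vec d" "v \<noteq> 0\<^sub>v d" "G *\<^sub>v v = l \<cdot>\<^sub>v v"
    using l(2) G_carrier by (auto simp: eigenvalue_def eigenvector_def)
  ultimately show "\<exists>v \<in> carrier_vec d. v \<noteq> 0\<^sub>v d \<and> v \<bullet> (G *\<^sub>v v) = (sigma_min B)\<^sup>2 * (v \<bullet> v)" by auto
  show "0 < (sigma_min B)\<^sup>2" using l(1,3) by simp
qed

text \<open>The images under \<open>B\<close> of the eigenvectors with nonzero eigenvalue are
  pairwise orthogonal with squared norms \<open>f k\<close>. They are therefore independent, and
  they lie in the column space whose dimension is the rank.\<close>

lemma card_nonzero_le_mrank: "card {k. k < d \<and> f k \<noteq> 0} \<le> mrank B"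
proof -
  interpret vec_space "TYPE(real)" n .
  define ks where "ks = filter (\<lambda>k. f k \<noteq> 0) [0..<d]"
  define C where "C = mat_of_cols n (map (\<lambda>k. B *\<^sub>v col P k) ks)"
  have ks: "k < d" "f k \<noteq> 0" if "k \<in> set ks" for k using that by (auto simp: ks_def)
  have dks: "distinct ks" by (simp add: ks_def)
  have len: "length ks = card {k. k < d \<and> f k \<noteq> 0}"
    using distinct_card[OF dks] by (simp add: ks_def)
  have C: "C \<in> carrier_mat n (length ks)"
    unfolding C_def using mat_of_cols_carrier(1)[of n "map (\<lambda>k. B *\<^sub>v col P k) ks"] by simp
  have colC: "col C i = B *\<^sub>v col P (ks ! i)" if "i < length ks" for i
    unfolding C_def using that B P ks[of "ks ! i"] by (subst col_mat_of_cols) auto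
  have CC: "col C i \<bullet> col C j = (if i = j then f (ks ! i) else 0)"
    if ij: "i < length ks" "j < length ks" for i j
  proof -
    have kk: "ks ! i < d" "ks ! j < d" using ks ij by auto
    have cP: "col P (ks ! i) \<in> carrier_vec d" "col P (ks ! j) \<in> carrier_vec d" using P kk by auto
    have "col C i \<bullet> col C j = (B\<^sup>T *\<^sub>v (B *\<^sub>v col P (ks ! i))) \<bullet> col P (ks ! j)"
      unfolding colC[OF ij(1)] colC[OF ij(2)]
      using transpose_vec_mult_scalar[OF B cP(2), of "B *\<^sub>v col P (ks ! i)"] B cP by simp
    also have "B\<^sup>T *\<^sub>v (B *\<^sub>v col P (ks ! i)) = f (ks ! i) \<cdot>\<^sub>v col P (ks ! i)"
      using G_col[OF kk(1)] B cP by (simp add: assoc_mult_mat_vec[of _ d n _ d])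
    also have "\<dots> \<bullet> col P (ks ! j) = (if ks ! i = ks ! j then f (ks ! i) else 0)"
      using cP col_P_orthonormal[OF kk] by simp
    finally show ?thesis using nth_eq_iff_index_eq[OF dks ij] by simp
  qed
  have fnz: "f (ks ! i) \<noteq> 0" if "i < length ks" for i using ks that by auto
  have dist: "distinct (cols C)"
    unfolding distinct_conv_nth using CC fnz C
    by (auto simp: cols_nth) (metis cols_nth C carrier_matD(2))
  have indpt: "lin_indpt (set (cols C))"
  proof
    assume "lin_dep (set (cols C))"
    then obtain v where v: "v \<in> carrier_vec (length ks)" "v \<noteq> 0\<^sub>v (length ks)" "C *\<^sub>v v = 0\<^sub>v n"
      using lin_depE[OF C _ dist] by blast
    have "v $ i = 0" if i: "i < length ks" for i
    proof -
      have "0 = (C\<^sup>T *\<^sub>v (C *\<^sub>v v)) $ i" unfolding v(3) using C i by simp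
      also have "C\<^sup>T *\<^sub>v (C *\<^sub>v v) = (C\<^sup>T * C) *\<^sub>v v"
        using C v by (simp add: assoc_mult_mat_vec[of _ "length ks" n _ "length ks"])
      also have "\<dots> $ i = (\<Sum>j<length ks. (C\<^sup>T * C) $$ (i,j) * v $ j)"
      proof -
        define M where "M = C\<^sup>T * C"
        have "M \<in> carrier_mat (length ks) (length ks)"
          unfolding M_def using C by (simp add: mult_carrier_mat[of _ _ n])
        then show ?thesis
          unfolding M_def[symmetric] using v(1) i by (simp add: scalar_prod_def atLeast0LessThan)
      qed
      also have "\<dots> = (\<Sum>j<length ks. (if i = j then f (ks ! i) else 0) * v $ j)"
        using C i CC by (intro sum.cong) auto
      also have "\<dots> = (\<Sum>j<length ks. if i = j then f (ks ! i) * v $ j else 0)"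
        by (rule sum.cong) auto
      also have "\<dots> = f (ks ! i) * v $ i" using i by simp
      finally show ?thesis using fnz[OF i] by simp
    qed
    then have "v = 0\<^sub>v (length ks)" using v(1) by (intro eq_vecI) auto
    then show False using v(2) by simp
  qed
  have colsB: "set (cols B) \<subseteq> carrier_vec n" using B cols_dim by blast
  have colsC: "set (cols C) \<subseteq> carrier_vec n" using C cols_dim by blast
  have "set (cols C) \<subseteq> span (set (cols B))"
  proof
    fix x assume "x \<in> set (cols C)"
    then obtain i where i: "i < length ks" "x = col C i"
      using C by (metis carrier_matD(2) cols_length cols_nth in_set_conv_nth)
    define v where "v = col P (ks ! i)"
    have v: "v \<in> carrier_vec d" unfolding v_def using P ks i by auto
    have "Matrix.vec d (\<lambda>j. v $ j) = v" using v by auto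
    moreover have "mat_of_cols n (cols B) = B" using B by (metis carrier_matD(1) mat_of_cols_cols)
    moreover have "\<forall>w\<in>set (cols B). dim_vec w = n" using colsB by auto
    ultimately have "lincomb_list (\<lambda>j. v $ j) (cols B) = B *\<^sub>v v"
      using lincomb_list_as_mat_mult[of "cols B" "\<lambda>j. v $ j"] B by simp
    then have "B *\<^sub>v v \<in> span_list (cols B)" using in_span_listI by metis
    then show "x \<in> span (set (cols B))"
      unfolding i(2) colC[OF i(1)] v_def[symmetric] using span_list_as_span[OF colsB] by simp
  qed
  then have sub: "span (set (cols C)) \<subseteq> span (set (cols B))"
    using colsB span_is_subset span_is_submodule by metis
  have sB: "subspace class_ring (span (set (cols B))) V" and sC: "subspace class_ring (span (set (cols C))) V"
    using colsB colsC span_is_subspace by auto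
  have "rank C \<le> rank B"
    unfolding rank_def
    using vectorspace.subspace_dim[OF subspace_is_vs[OF sB] nested_subspaces[OF sB sC sub]]
      fin_dim_span_cols[OF B] fin_dim_span_cols[OF C] by simp
  moreover have "rank C = length ks" using lin_indpt_full_rank[OF C dist indpt] .
  ultimately show ?thesis using B by (simp add: mrank_def len)
qed

text \<open>This is where the rank replaces the dimension: once m^d is pulled out, zero eigenvalues
  contribute the factor 1. The power m^d later cancels against det (m I).\<close>

lemma det_ridge_le:
  assumes m: "0 < m"
  shows "Determinant.det (G + m \<cdot>\<^sub>m 1\<^sub>m d) \<le> m ^ d * (1 + (spec_norm B)\<^sup>2 / m) ^ mrank B"
proof -
  let ?D = "mat_diag d (\<lambda>k. f k + m)"
  have "P * ?D * P\<^sup>T = P * (mat_diag d f + m \<cdot>\<^sub>m 1\<^sub>m d) * P\<^sup>T"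
    by (rule arg_cong[of _ _ "\<lambda>M. P * M * P\<^sup>T"], rule eq_matI) (auto simp: mat_diag_def)
  also have "\<dots> = G + m \<cdot>\<^sub>m (P * P\<^sup>T)"
    unfolding diag using P PT
    by (simp add: mult_add_distrib_mat[of _ d d _ d] add_mult_distrib_mat[of _ d d _ _ d]
        mult_carrier_mat[of _ d d _ d] mult_smult_distrib[of _ d d _ d] mult_smult_assoc_mat[of _ d d _ d])
  finally have "Determinant.det (G + m \<cdot>\<^sub>m 1\<^sub>m d) = Determinant.det (P * ?D * P\<^sup>T)" by (simp add: PPT)
  also have "\<dots> = Determinant.det P * Determinant.det ?D * Determinant.det P\<^sup>T"
    using P PT by (simp add: Determinant.det_mult[of _ d] mult_carrier_mat[of _ d d _ d])
  also have "Determinant.det P * Determinant.det P\<^sup>T = 1"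
    using Determinant.det_mult[OF P PT] by (simp add: PPT)
  then have "Determinant.det P * Determinant.det ?D * Determinant.det P\<^sup>T = Determinant.det ?D" by (metis mult.commute mult.left_commute mult_1)
  also have "Determinant.det ?D = (\<Prod>k<d. f k + m)"
    by (subst det_upper_triangular[of _ d])
      (auto simp: mat_diag_def diag_mat_def upper_triangular_def prod.list_conv_set_nth atLeast0LessThan)
  also have "\<dots> = (\<Prod>k<d. m * (1 + f k / m))"
    using m by (intro prod.cong) (auto simp: field_simps)
  also have "\<dots> = m ^ d * (\<Prod>k<d. 1 + f k / m)" by (simp add: prod.distrib)
  also have "(\<Prod>k<d. 1 + f k / m) = (\<Prod>k\<in>{k. k < d \<and> f k \<noteq> 0}. 1 + f k / m)"
    by (rule prod.mono_neutral_right) auto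
  also have "\<dots> \<le> (\<Prod>k\<in>{k. k < d \<and> f k \<noteq> 0}. 1 + (spec_norm B)\<^sup>2 / m)"
    using m f_nonneg f_le_spec_norm
    by (intro prod_mono) (auto simp: divide_right_mono intro!: add_nonneg_nonneg)
  also have "\<dots> = (1 + (spec_norm B)\<^sup>2 / m) ^ card {k. k < d \<and> f k \<noteq> 0}" by simp
  also have "\<dots> \<le> (1 + (spec_norm B)\<^sup>2 / m) ^ mrank B"
    using m card_nonzero_le_mrank by (intro power_increasing) auto
  finally show ?thesis using m by simp
qed

end

section \<open>The condition number \<open>mu\<close> and the prefixes of the matrix\<close>

lemma gram_diagonalization_exists:
  assumes "B \<in> carrier_mat n d"
  obtains P f where "gram_diagonalization n d B P f"
proof -
  have "B\<^sup>T * B \<in> carrier_mat d d" "(B\<^sup>T * B)\<^sup>T = B\<^sup>T * B"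
    using assms by (auto simp: mult_carrier_mat[of _ d n _ d] transpose_mult[of _ d n _ d])
  from symmetric_real_diagonalization[OF this] show ?thesis
    using assms that by (auto simp: gram_diagonalization_def)
qed

lemma first_rows_gram:
  assumes "A \<in> carrier_mat n d"
  shows "(first_rows i A)\<^sup>T * first_rows i A = gram d (take i (Matrix.rows A))"
  using assms by (simp add: first_rows_def gram_def)

lemma first_rows_carrier:
  assumes "A \<in> carrier_mat n d" "i \<le> n"
  shows "first_rows i A \<in> carrier_mat i d"
  using assms by (auto simp: first_rows_def mat_of_rows_def)

text \<open>Collects what the rest of the proof uses about singular values. The last clause says
  that every prefix Gram matrix is at least \<open>m\<close> on its own range, which makes a ridge
  of size \<open>m\<close> harmless there.\<close>

lemma mu_witness:
  fixes A :: "real mat"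
  assumes A: "A \<in> carrier_mat n d" and nz: "A \<noteq> 0\<^sub>m n d"
  obtains m where "0 < m" "mu A = (spec_norm A)\<^sup>2 / m" "m \<le> (spec_norm A)\<^sup>2"
    "\<And>i x y. \<lbrakk>1 \<le> i; i \<le> n; y \<in> carrier_vec d; x = gram d (take i (Matrix.rows A)) *\<^sub>v y\<rbrakk>
      \<Longrightarrow> m * (x \<bullet> x) \<le> x \<bullet> (gram d (take i (Matrix.rows A)) *\<^sub>v x)"
proof -
  let ?F = "\<lambda>i. first_rows i A"
  let ?M = "{(sigma_min (?F i))\<^sup>2 | i. 1 \<le> i \<and> i \<le> dim_row A \<and> ?F i \<noteq> 0\<^sub>m i (dim_col A)}"
  define m where "m = Min ?M"
  have n: "1 \<le> n" using A nz by (cases n) (auto intro!: eq_matI)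
  have fin: "finite ?M" by simp
  have "?F n = A" using A by (metis carrier_matD first_rows_def length_rows mat_of_rows_rows take_all_iff order_refl)
  then have "?M \<noteq> {}" using A nz n by auto
  then have "m \<in> ?M" unfolding m_def using fin by (rule Min_in[rotated])
  then obtain i where i: "m = (sigma_min (?F i))\<^sup>2" "1 \<le> i" "i \<le> n" "?F i \<noteq> 0\<^sub>m i d" using A by auto
  obtain P f where "gram_diagonalization i d (?F i) P f"
    using gram_diagonalization_exists[OF first_rows_carrier[OF A i(3)]] .
  then interpret Fi: gram_diagonalization i d "?F i" P f .
  have m0: "0 < m" using Fi.sigma_min_attained(2)[OF i(4)] i(1) by simp
  obtain Q g where "gram_diagonalization n d A Q g"
    using gram_diagonalization_exists[OF A] .
  then interpret A: gram_diagonalization n d A Q g .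
  obtain v where v: "v \<in> carrier_vec d" "v \<noteq> 0\<^sub>v d" "v \<bullet> (Fi.G *\<^sub>v v) = m * (v \<bullet> v)"
    using Fi.sigma_min_attained(1)[OF i(4)] i(1) by auto
  have rc: "set (Matrix.rows A) \<subseteq> carrier_vec d" using rows_carrier[OF A] .
  have tc: "set (take i (Matrix.rows A)) \<subseteq> carrier_vec d" for i using rc set_take_subset by fastforce
  \<comment> \<open>At a vector that realizes the smallest nonzero singular value of the minimizing
    prefix, the remaining rows only increase the form. Hence \<open>m\<close> is at most the squared
    norm of the full matrix, which means \<open>mu A\<close> is at least 1.\<close>
  have "m * (v \<bullet> v) = (\<Sum>r\<leftarrow>take i (Matrix.rows A). (r \<bullet> v)\<^sup>2)"
    using v(3) gram_quadratic_form[OF tc v(1)] by (simp add: first_rows_gram[OF A])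
  also have "\<dots> \<le> (\<Sum>r\<leftarrow>take i (Matrix.rows A). (r \<bullet> v)\<^sup>2) + (\<Sum>r\<leftarrow>drop i (Matrix.rows A). (r \<bullet> v)\<^sup>2)"
    by (auto intro!: sum_list_nonneg)
  also have "\<dots> = (\<Sum>r\<leftarrow>Matrix.rows A. (r \<bullet> v)\<^sup>2)"
    by (metis append_take_drop_id map_append sum_list_append)
  also have "\<dots> = v \<bullet> (A.G *\<^sub>v v)"
    using gram_quadratic_form[OF rc v(1)] gram_rows[OF A] by simp
  also have "\<dots> \<le> (spec_norm A)\<^sup>2 * (v \<bullet> v)"
    using A.rayleigh_upper[OF v(1) A.f_le_spec_norm] .
  finally have mS: "m \<le> (spec_norm A)\<^sup>2" using scalar_prod_self_pos[OF v(1,2)] by simp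
  show ?thesis
  proof (rule that[OF m0 _ mS])
    show "mu A = (spec_norm A)\<^sup>2 / m" by (simp add: mu_def m_def)
    fix j x y assume j: "1 \<le> j" "j \<le> n" and y: "y \<in> carrier_vec d"
      and x: "x = gram d (take j (Matrix.rows A)) *\<^sub>v y"
    obtain R h where "gram_diagonalization j d (?F j) R h"
      using gram_diagonalization_exists[OF first_rows_carrier[OF A j(2)]] .
    then interpret Fj: gram_diagonalization j d "?F j" R h .
    note Gj = first_rows_gram[OF A, of j, symmetric]
    show "m * (x \<bullet> x) \<le> x \<bullet> (gram d (take j (Matrix.rows A)) *\<^sub>v x)"
    proof (cases "?F j = 0\<^sub>m j d")
      \<comment> \<open>A zero prefix is left out of the minimum in \<open>mu\<close>, but its range
        contains only x = 0.\<close>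
      case True
      then have "x = 0\<^sub>v d" unfolding x Gj using y by (auto intro!: eq_vecI)
      then show ?thesis using Fj.G_carrier unfolding Gj by simp
    next
      case False
      then have "(sigma_min (?F j))\<^sup>2 \<in> ?M" using j A by auto
      then have "m \<le> (sigma_min (?F j))\<^sup>2" unfolding m_def using fin by (intro Min_le)
      then have "m \<le> h k" if "k < d" "h k \<noteq> 0" for k
        using Fj.sigma_min_le_f[OF that] by linarith
      then show ?thesis unfolding x Gj using Fj.rayleigh_lower_on_range[OF y] by blast
    qed
  qed
qed

lemma spec_norm_zero:
  assumes "A = 0\<^sub>m n d"
  shows "spec_norm A = 0"
proof -
  have A: "A \<in> carrier_mat n d" using assms by simp
  obtain P f where "gram_diagonalization n d A P f"
    using gram_diagonalization_exists[OF A] .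
  then interpret gram_diagonalization n d A P f .
  have Gv: "G *\<^sub>v v = 0\<^sub>v d" if "v \<in> carrier_vec d" for v
    using that by (intro eq_vecI) (auto simp: assms)
  have "s = 0" if s: "s \<in> singular_values A" for s
  proof -
    obtain l where l: "s = sqrt l" "eigenvalue G l" using s by (auto simp: singular_values_def)
    then obtain v where v: "v \<in> carrier_vec d" "v \<noteq> 0\<^sub>v d" "G *\<^sub>v v = l \<cdot>\<^sub>v v"
      using G_carrier by (auto simp: eigenvalue_def eigenvector_def)
    then have "l * (v \<bullet> v) = 0"
      using Gv[OF v(1)] v(1) by (metis scalar_prod_right_zero scalar_prod_smult_distrib)
    then show ?thesis using scalar_prod_self_pos[OF v(1,2)] l by simp
  qed
  then show ?thesis
    unfolding spec_norm_def using Max_in[OF finite_singular_values] by auto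
qed

subsection \<open>Ridge leverage scores\<close>

lemma pd_add_ridge:
  assumes M: "psd d M" and m: "0 < m"
  shows "pd d (M + m \<cdot>\<^sub>m 1\<^sub>m d)"
proof -
  have c: "M \<in> carrier_mat d d" "M\<^sup>T = M" using M by (auto simp: psd_def)
  have q: "x \<bullet> ((M + m \<cdot>\<^sub>m 1\<^sub>m d) *\<^sub>v x) = x \<bullet> (M *\<^sub>v x) + m * (x \<bullet> x)" if "x \<in> carrier_vec d" for x
    using that c by (simp add: quadratic_form_add[of _ d] quadratic_form_smult[of _ d])
  have s: "(m \<cdot>\<^sub>m 1\<^sub>m d)\<^sup>T = m \<cdot>\<^sub>m 1\<^sub>m d" by (rule eq_matI) auto
  have "0 < x \<bullet> ((M + m \<cdot>\<^sub>m 1\<^sub>m d) *\<^sub>v x)" if x: "x \<in> carrier_vec d" "x \<noteq> 0\<^sub>v d" for x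
    using q[OF x(1)] M m x scalar_prod_self_pos[OF x] by (auto simp: psd_def intro!: add_nonneg_pos)
  moreover have "0 \<le> x \<bullet> ((M + m \<cdot>\<^sub>m 1\<^sub>m d) *\<^sub>v x)" if x: "x \<in> carrier_vec d" for x
    using q[OF x] M m x scalar_prod_self_nonneg[of x] by (auto simp: psd_def)
  ultimately show ?thesis using c s by (auto simp: pd_def psd_def transpose_add[of _ d d])
qed

text \<open>Online ridge leverage scores: \<open>Suc i\<close> puts each row into the prefix against
  which it is scored, which keeps every score below 1.\<close>

definition ridge_lev_sum :: "nat \<Rightarrow> real \<Rightarrow> real Matrix.vec list \<Rightarrow> real" where
  "ridge_lev_sum d m rs = (\<Sum>i<length rs. lev (gram d (take (Suc i) rs) + m \<cdot>\<^sub>m 1\<^sub>m d) (rs ! i))"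

lemma ridge_lev_sum_snoc:
  "ridge_lev_sum d m (rs @ [a]) = ridge_lev_sum d m rs + lev (gram d (rs @ [a]) + m \<cdot>\<^sub>m 1\<^sub>m d) a"
  by (auto simp: ridge_lev_sum_def nth_append intro!: sum.cong)

text \<open>If tau is the score of the new row before it is added, the determinant grows by the
  factor 1 + tau, while the score afterwards is tau / (1 + tau) = 1 - 1 / (1 + tau) <= ln (1 + tau).
  Positivity of the determinant is carried along so that the logarithm of the product
  splits.\<close>

lemma ridge_lev_sum_le_ln_det:
  assumes "set rs \<subseteq> carrier_vec d" and m: "0 < m"
  shows "0 < Determinant.det (gram d rs + m \<cdot>\<^sub>m 1\<^sub>m d) \<and>
    ridge_lev_sum d m rs \<le> ln (Determinant.det (gram d rs + m \<cdot>\<^sub>m 1\<^sub>m d)) - real d * ln m"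
  using assms(1)
proof (induction rs rule: rev_induct)
  case Nil
  have "0\<^sub>m d d + m \<cdot>\<^sub>m 1\<^sub>m d = m \<cdot>\<^sub>m (1\<^sub>m d :: real mat)" by (rule eq_matI) auto
  then show ?case using m by (simp add: gram_Nil ridge_lev_sum_def ln_realpow)
next
  case (snoc a rs)
  let ?M = "gram d rs + m \<cdot>\<^sub>m 1\<^sub>m d"
  let ?M' = "gram d (rs @ [a]) + m \<cdot>\<^sub>m 1\<^sub>m d"
  have a: "a \<in> carrier_vec d" and rs: "set rs \<subseteq> carrier_vec d" using snoc.prems by auto
  have pdM: "pd d ?M" using pd_add_ridge[OF gram_psd[OF rs] m] .
  then have psdM: "psd d ?M" by (simp add: pd_def)
  obtain w where w: "w \<in> carrier_vec d" "?M *\<^sub>v w = a" using pd_solve[OF pdM a] .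
  have tau: "lev ?M a = a \<bullet> w" using lev_eq_scalar_prod[OF psdM w] .
  have tau0: "0 \<le> lev ?M a" using lev_nonneg[OF psdM w] .
  have M': "?M' = ?M + outer a" "?M' = ?M + 1 \<cdot>\<^sub>m outer a"
    using a by (auto simp: gram_snoc[OF rs a] outer_def intro!: eq_matI)
  have det: "Determinant.det ?M' = Determinant.det ?M * (1 + lev ?M a)"
    unfolding M'(1) tau using det_add_outer[OF _ a w] by simp
  have "lev ?M' a = lev ?M a - (lev ?M a)\<^sup>2 * (1 / (1 + lev ?M a))"
    using lev_rank_one_update(2)[OF pdM a _ w, of 1] tau0 unfolding M'(2) tau by simp
  also have "\<dots> = 1 - 1 / (1 + lev ?M a)"
    using tau0 by (simp add: field_simps power2_eq_square)
  also have "\<dots> \<le> ln (1 + lev ?M a)"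
    using ln_le_minus_one[of "1 / (1 + lev ?M a)"] tau0 by (simp add: ln_div)
  finally have "lev ?M' a \<le> ln (1 + lev ?M a)" .
  moreover have "ln (Determinant.det ?M') = ln (Determinant.det ?M) + ln (1 + lev ?M a)"
    unfolding det using snoc.IH[OF rs] tau0 by (intro ln_mult_pos) auto
  moreover have "0 < Determinant.det ?M'" unfolding det using snoc.IH[OF rs] tau0 by (intro mult_pos_pos) auto
  ultimately show ?case using snoc.IH[OF rs] by (simp add: ridge_lev_sum_snoc)
qed

lemma ridge_lev_sum_le:
  assumes A: "A \<in> carrier_mat n d" and m: "0 < m"
  shows "ridge_lev_sum d m (Matrix.rows A) \<le> real (mrank A) * ln (1 + (spec_norm A)\<^sup>2 / m)"
proof -
  obtain P f where "gram_diagonalization n d A P f"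
    using gram_diagonalization_exists[OF A] .
  then interpret gram_diagonalization n d A P f .
  have "0 < 1 + (spec_norm A)\<^sup>2 / m" using m by (simp add: add_pos_nonneg)
  note sum = ridge_lev_sum_le_ln_det[OF rows_carrier[OF A] m, unfolded gram_rows[OF A]]
  have "ln (Determinant.det (G + m \<cdot>\<^sub>m 1\<^sub>m d)) \<le> ln (m ^ d * (1 + (spec_norm A)\<^sup>2 / m) ^ mrank A)"
    using det_ridge_le[OF m] sum by simp
  also have "\<dots> = real d * ln m + real (mrank A) * ln (1 + (spec_norm A)\<^sup>2 / m)"
    using m \<open>0 < 1 + (spec_norm A)\<^sup>2 / m\<close> by (simp add: ln_mult_pos ln_realpow)
  finally show ?thesis using sum by simp
qed

subsection \<open>Barriers\<close>

text \<open>The two barriers are treated at once: \<open>\<sigma> = 1\<close> is the upper one and \<open>\<sigma> = -1\<close> the lower one;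
  \<open>bs\<close> are the rows read so far and \<open>rs\<close> the rescaled rows that were kept.\<close>
definition diff_gram :: "real \<Rightarrow> real \<Rightarrow> nat \<Rightarrow> real Matrix.vec list \<Rightarrow> real Matrix.vec list \<Rightarrow> real mat" where
  "diff_gram \<sigma> c d bs rs = \<sigma> \<cdot>\<^sub>m (c \<cdot>\<^sub>m gram d bs - gram d rs)"

lemma diff_gram_carrier [simp]: "diff_gram \<sigma> c d bs rs \<in> carrier_mat d d"
  by (simp add: diff_gram_def minus_carrier_mat)

lemma gram_index_sym: "i < d \<Longrightarrow> j < d \<Longrightarrow> gram d rs $$ (i, j) = gram d rs $$ (j, i)"
  using gram_transpose[of d rs] by (metis gram_dim index_transpose_mat(1))

lemma diff_gram_transpose [simp]: "(diff_gram \<sigma> c d bs rs)\<^sup>T = diff_gram \<sigma> c d bs rs"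
  by (rule eq_matI) (auto simp: diff_gram_def gram_index_sym[of _ d])

lemma diff_gram_quadratic_form:
  assumes "x \<in> carrier_vec d"
  shows "x \<bullet> (diff_gram \<sigma> c d bs rs *\<^sub>v x) = \<sigma> * (c * (x \<bullet> (gram d bs *\<^sub>v x)) - x \<bullet> (gram d rs *\<^sub>v x))"
  using assms unfolding diff_gram_def
  by (simp add: quadratic_form_smult[of _ d] quadratic_form_minus[of _ d] minus_carrier_mat)

text \<open>Processing row \<open>a\<close> changes the weight of its outer product in \<open>diff_gram\<close> by this amount.\<close>
definition step_coeff :: "real \<Rightarrow> real \<Rightarrow> real \<Rightarrow> bool \<Rightarrow> real" where
  "step_coeff \<sigma> c p b = \<sigma> * (c - (if b then 1 / p else 0))"

definition keep_row :: "real \<Rightarrow> real Matrix.vec \<Rightarrow> bool \<Rightarrow> real Matrix.vec list \<Rightarrow> real Matrix.vec list" where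
  "keep_row p a b rs = (if b then rs @ [(1 / sqrt p) \<cdot>\<^sub>v a] else rs)"

lemma keep_row_carrier:
  "set rs \<subseteq> carrier_vec d \<Longrightarrow> a \<in> carrier_vec d \<Longrightarrow> set (keep_row p a b rs) \<subseteq> carrier_vec d"
  by (auto simp: keep_row_def)

lemma outer_smult: "0 < p \<Longrightarrow> outer ((1 / sqrt p) \<cdot>\<^sub>v a) = (1 / p) \<cdot>\<^sub>m outer a"
  by (rule eq_matI) (auto simp: outer_def field_simps)

lemma diff_gram_step:
  assumes bs: "set bs \<subseteq> carrier_vec d" and rs: "set rs \<subseteq> carrier_vec d" and a: "a \<in> carrier_vec d" and p: "b \<Longrightarrow> 0 < p"
  shows "diff_gram \<sigma> c d (bs @ [a]) (keep_row p a b rs) = diff_gram \<sigma> c d bs rs + step_coeff \<sigma> c p b \<cdot>\<^sub>m outer a"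
proof -
  have oa: "outer a \<in> carrier_mat d d" using a by simp
  have ra: "(1 / sqrt p) \<cdot>\<^sub>v a \<in> carrier_vec d" using a by simp
  show ?thesis
    by (rule eq_matI)
      (use oa p in \<open>auto simp: diff_gram_def keep_row_def step_coeff_def gram_snoc[OF bs a] gram_snoc[OF rs ra]
        outer_smult algebra_simps\<close>)
qed

text \<open>X^U of the algorithm for sigma = 1 and X^L for sigma = -1.\<close>

definition barrier :: "real \<Rightarrow> real \<Rightarrow> nat \<Rightarrow> real Matrix.vec list \<Rightarrow> real Matrix.vec list \<Rightarrow> real Matrix.vec \<Rightarrow> real mat" where
  "barrier eps \<sigma> d bs rs a = diff_gram \<sigma> (1 + \<sigma> * eps) d bs rs + outer a"

section \<open>One step seen from a single barrier\<close>

context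
  fixes eps \<sigma> :: real and d :: nat and bs rs :: "real Matrix.vec list" and a :: "real Matrix.vec"
  assumes eps: "0 < eps" "eps < 1" and \<sigma>: "\<sigma> = 1 \<or> \<sigma> = -1"
    and bs: "set bs \<subseteq> carrier_vec d" and rs: "set rs \<subseteq> carrier_vec d" and a: "a \<in> carrier_vec d"
    and inv: "psd d (diff_gram \<sigma> (1 + \<sigma> * eps) d bs rs)"
begin

private abbreviation "X \<equiv> barrier eps \<sigma> d bs rs a"
private abbreviation "U \<equiv> diff_gram \<sigma> (1 + \<sigma> * eps) d bs rs"

lemma barrier_quadratic_form:
  assumes x: "x \<in> carrier_vec d"
  shows "x \<bullet> (X *\<^sub>v x) = x \<bullet> (U *\<^sub>v x) + (a \<bullet> x)\<^sup>2"
  unfolding barrier_def using x a by (simp add: quadratic_form_add[of _ d] outer_quadratic_form[of _ d])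

lemma diff_gram_nonneg: "x \<in> carrier_vec d \<Longrightarrow> 0 \<le> x \<bullet> (U *\<^sub>v x)"
  using inv by (simp add: psd_def)

lemma barrier_psd: "psd d X"
proof -
  have "X \<in> carrier_mat d d" "X\<^sup>T = X"
    unfolding barrier_def using a by (auto simp: transpose_add[of _ d d])
  then show ?thesis
    unfolding psd_def using barrier_quadratic_form diff_gram_nonneg by simp
qed

text \<open>\<open>X\<close> dominates \<open>outer a\<close>, so \<open>a\<close> lies in its range
  and the score built from the pseudo-inverse obeys Cauchy-Schwarz.\<close>

lemma barrier_range: obtains y where "y \<in> carrier_vec d" "X *\<^sub>v y = a"
  using range_if_square_le_quadratic_form[OF barrier_psd a, of 1] barrier_quadratic_form diff_gram_nonneg by force

lemma lev_barrier_nonneg: "0 \<le> lev X a"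
  using barrier_range lev_nonneg[OF barrier_psd] by metis

lemma lev_barrier_pos: "a \<noteq> 0\<^sub>v d \<Longrightarrow> 0 < lev X a"
  using barrier_range lev_pos[OF barrier_psd] by metis

lemma barrier_cauchy_schwarz: "x \<in> carrier_vec d \<Longrightarrow> (a \<bullet> x)\<^sup>2 \<le> lev X a * (x \<bullet> (X *\<^sub>v x))"
  using barrier_range lev_cauchy_schwarz[OF barrier_psd] by metis

text \<open>With s the step coefficient, the new matrix is X - (1 - s) a a^T, and Cauchy-Schwarz
  puts a a^T below \<open>lev X a\<close> times X. So either s >= 0 or (1 - s) *
  \<open>lev X a\<close> <= 1 suffices. The hypothesis on \<open>b\<close> excludes the null event
  that a row with p = 1 is dropped.\<close>

lemma diff_gram_psd_step:
  assumes p: "0 < p" "p \<le> 1" "p < 1 \<Longrightarrow> (2 / eps + \<sigma>) * lev X a \<le> p" and b: "b \<or> p < 1"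
  shows "psd d (diff_gram \<sigma> (1 + \<sigma> * eps) d (bs @ [a]) (keep_row p a b rs))"
proof -
  let ?s = "step_coeff \<sigma> (1 + \<sigma> * eps) p b"
  define l where "l = lev X a"
  have l: "0 \<le> l" unfolding l_def by (rule lev_barrier_nonneg)
  \<comment> \<open>A negative coefficient can only come from a kept row at the upper barrier or a
    dropped row at the lower one; in these two cases the lower bound on \<open>p\<close> gives the
    second alternative.\<close>
  have s: "0 \<le> ?s \<or> (1 - ?s) * l \<le> 1"
  proof (cases "p < 1")
    case False
    then have "p = 1" "b" using p b by auto
    then show ?thesis using \<sigma> eps by (auto simp: step_coeff_def)
  next
    case True
    then have pl: "(2 / eps + \<sigma>) * l \<le> p" using p unfolding l_def by simp
    show ?thesis
    proof (cases "\<sigma> = 1")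
      case s1: True
      show ?thesis
      proof (cases b)
        case False then show ?thesis using s1 eps by (simp add: step_coeff_def)
      next
        case b: True
        have "l \<le> (2 / eps + 1) * l" using l eps by (simp add: distrib_right)
        then have "l \<le> p" using pl s1 by simp
        then have "l / p \<le> 1" using p by simp
        moreover have "(1 - ?s) * l = l / p - eps * l" using s1 b by (simp add: step_coeff_def algebra_simps)
        ultimately have "(1 - ?s) * l \<le> 1" using mult_nonneg_nonneg[of eps l] l eps by linarith
        then show ?thesis by simp
      qed
    next
      case False
      then have s1: "\<sigma> = -1" using \<sigma> by simp
      show ?thesis
      proof (cases b)
        case True
        have "1 \<le> 1 / p" using p by simp
        then show ?thesis using s1 True eps by (simp add: step_coeff_def)
      next
        case b: False
        have "(2 - eps) * l = eps * ((2 / eps + \<sigma>) * l)" using s1 eps by (simp add: field_simps)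
        also have "\<dots> \<le> eps * p" using pl eps by simp
        also have "\<dots> \<le> 1 * 1" using p eps by (intro mult_mono) auto
        finally show ?thesis using s1 b by (simp add: step_coeff_def)
      qed
    qed
  qed
  have "0 \<le> x \<bullet> (U *\<^sub>v x) + ?s * (a \<bullet> x)\<^sup>2" if x: "x \<in> carrier_vec d" for x
  proof (cases "0 \<le> ?s")
    case True then show ?thesis using diff_gram_nonneg[OF x] by simp
  next
    case False
    then have s1: "(1 - ?s) * l \<le> 1" using s by blast
    have "(1 - ?s) * (a \<bullet> x)\<^sup>2 \<le> (1 - ?s) * (l * (x \<bullet> (X *\<^sub>v x)))"
      using barrier_cauchy_schwarz[OF x] False unfolding l_def by (intro mult_left_mono) auto
    also have "\<dots> = ((1 - ?s) * l) * (x \<bullet> (X *\<^sub>v x))" by simp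
    also have "\<dots> \<le> 1 * (x \<bullet> (X *\<^sub>v x))"
      using s1 barrier_psd x by (intro mult_right_mono) (auto simp: psd_def)
    finally show ?thesis using barrier_quadratic_form[OF x] by (simp add: algebra_simps)
  qed
  moreover have "x \<bullet> ((U + ?s \<cdot>\<^sub>m outer a) *\<^sub>v x) = x \<bullet> (U *\<^sub>v x) + ?s * (a \<bullet> x)\<^sup>2" if x: "x \<in> carrier_vec d" for x
    using x a by (simp add: quadratic_form_add[of _ d] quadratic_form_smult[of _ d] outer_quadratic_form[of _ d])
  ultimately have "0 \<le> x \<bullet> (diff_gram \<sigma> (1 + \<sigma> * eps) d (bs @ [a]) (keep_row p a b rs) *\<^sub>v x)"
    if "x \<in> carrier_vec d" for x
    using that diff_gram_step[OF bs rs a, of b p \<sigma> "1 + \<sigma> * eps"] p by simp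
  then show ?thesis by (simp add: psd_def)
qed

section \<open>The shifted barrier matrices Y_j and their expected scores\<close>

context
  fixes T :: "real mat" and \<theta> :: real
  assumes T: "T \<in> carrier_mat d d" "T\<^sup>T = T" and \<theta>: "0 < \<theta>"
    and T_ge: "\<And>x. x \<in> carrier_vec d \<Longrightarrow> eps / 2 * (x \<bullet> (gram d (bs @ [a]) *\<^sub>v x)) + \<theta> * (x \<bullet> x) \<le> x \<bullet> (T *\<^sub>v x)"
begin

private abbreviation "c \<equiv> 1 + \<sigma> * eps / 2"
private abbreviation "Y \<equiv> T + diff_gram \<sigma> c d bs rs"

text \<open>Because sigma^2 = 1, moving eps/2 times the Gram matrix of the rows read so far out of
  \<open>T\<close> changes the slope 1 + sigma eps/2 into 1 + sigma eps. The hypothesis on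
  \<open>T\<close> also covers the row \<open>a\<close> being read, which leaves the surplus eps/2 *
  (a . x)^2. \<open>T\<close> is only bounded from below so that one fixed \<open>T\<close> can
  serve all earlier prefixes.\<close>

lemma shifted_quadratic_form:
  assumes x: "x \<in> carrier_vec d"
  shows "x \<bullet> (Y *\<^sub>v x) = x \<bullet> (T *\<^sub>v x) - eps / 2 * (x \<bullet> (gram d (bs @ [a]) *\<^sub>v x)) + x \<bullet> (U *\<^sub>v x) + eps / 2 * (a \<bullet> x)\<^sup>2"
proof -
  have "x \<bullet> (gram d (bs @ [a]) *\<^sub>v x) = x \<bullet> (gram d bs *\<^sub>v x) + (a \<bullet> x)\<^sup>2"
    using x a by (simp add: gram_snoc[OF bs a] quadratic_form_add[of _ d] outer_quadratic_form[of _ d])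
  moreover have "x \<bullet> (Y *\<^sub>v x) = x \<bullet> (T *\<^sub>v x) + x \<bullet> (diff_gram \<sigma> c d bs rs *\<^sub>v x)"
    using x T by (simp add: quadratic_form_add[of _ d])
  moreover have "\<sigma> * (c * g - h) = \<sigma> * ((1 + \<sigma> * eps) * g - h) - eps / 2 * g" for g h
    using \<sigma> by (auto simp: algebra_simps)
  ultimately show ?thesis
    unfolding diff_gram_quadratic_form[OF x] by (simp add: distrib_left)
qed

lemma shifted_quadratic_form_ge:
  assumes x: "x \<in> carrier_vec d"
  shows "x \<bullet> (X *\<^sub>v x) - (1 - eps / 2) * (a \<bullet> x)\<^sup>2 + \<theta> * (x \<bullet> x) \<le> x \<bullet> (Y *\<^sub>v x)"
  using T_ge[OF x] unfolding shifted_quadratic_form[OF x] barrier_quadratic_form[OF x] by (simp add: algebra_simps)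

lemma shifted_pd: "pd d Y"
proof -
  have ge: "\<theta> * (x \<bullet> x) \<le> x \<bullet> (Y *\<^sub>v x)" if x: "x \<in> carrier_vec d" for x
  proof -
    have "0 \<le> eps / 2 * (a \<bullet> x)\<^sup>2" using eps by simp
    then show ?thesis
      using shifted_quadratic_form_ge[OF x] diff_gram_nonneg[OF x] unfolding barrier_quadratic_form[OF x] by (simp add: algebra_simps)
  qed
  have "0 < x \<bullet> (Y *\<^sub>v x)" if x: "x \<in> carrier_vec d" "x \<noteq> 0\<^sub>v d" for x
    using ge[OF x(1)] mult_pos_pos[OF \<theta> scalar_prod_self_pos[OF x]] by linarith
  moreover have "0 \<le> x \<bullet> (Y *\<^sub>v x)" if x: "x \<in> carrier_vec d" for x
    using ge[OF x] mult_nonneg_nonneg[of \<theta> "x \<bullet> x"] \<theta> scalar_prod_self_nonneg[of x] by linarith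
  ultimately show ?thesis using T by (simp add: pd_def psd_def transpose_add[of _ d d])
qed

text \<open>By Sherman-Morrison, subtracting (1 - eps/2) a a^T lowers the reciprocal of a score by 1
  - eps/2. This is the inequality version, obtained by testing the solution \<open>w\<close> for
  \<open>Y\<close> in the form of \<open>X\<close>, so that no inverse of the possibly singular
  \<open>X\<close> occurs.\<close>

lemma lev_shifted_vs_barrier:
  assumes nz: "a \<noteq> 0\<^sub>v d"
  shows "0 < lev Y a" "1 / lev X a - (1 - eps / 2) \<le> 1 / lev Y a"
proof -
  have Yp: "psd d Y" using shifted_pd by (simp add: pd_def)
  obtain w where w: "w \<in> carrier_vec d" "Y *\<^sub>v w = a" using pd_solve[OF shifted_pd a] .
  let ?t = "lev Y a" and ?l = "lev X a"
  show t: "0 < ?t" using lev_pos[OF Yp w nz] .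
  have l: "0 < ?l" using lev_barrier_pos[OF nz] .
  have aw: "a \<bullet> w = ?t" using lev_eq_scalar_prod[OF Yp w] by simp
  have "w \<bullet> (Y *\<^sub>v w) = ?t" using aw w comm_scalar_prod[OF a w(1)] by simp
  moreover have "0 \<le> \<theta> * (w \<bullet> w)" using \<theta> scalar_prod_self_nonneg[of w] by simp
  ultimately have "w \<bullet> (X *\<^sub>v w) - (1 - eps / 2) * ?t\<^sup>2 \<le> ?t"
    using shifted_quadratic_form_ge[OF w(1)] aw by simp
  moreover have "?t\<^sup>2 / ?l \<le> w \<bullet> (X *\<^sub>v w)"
    using barrier_cauchy_schwarz[OF w(1)] aw l by (simp add: divide_le_eq mult.commute)
  ultimately have "?t\<^sup>2 / ?l - (1 - eps / 2) * ?t\<^sup>2 \<le> ?t" by linarith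
  then have "(1 / ?l - (1 - eps / 2)) * ?t\<^sup>2 \<le> 1 / ?t * ?t\<^sup>2"
    using t by (simp add: power2_eq_square left_diff_distrib)
  then show "1 / ?l - (1 - eps / 2) \<le> 1 / ?t"
    by (rule mult_right_le_imp_le) (use t in simp)
qed

text \<open>The two scalar facts behind the supermartingale: the rank-one update is admissible on
  each outcome of positive probability, and the expected decrease of the score is nonnegative. With
  u and v the coefficients for keeping and dropping and t the score, they satisfy p u + (1 - p) v =
  eps/2 and u v = c (c - 1/p). When p < 1, the second claim thus reduces to c <= p (eps / (2 t) +
  c^2).\<close>

lemma step_coeff_bounds:
  assumes nz: "a \<noteq> 0\<^sub>v d"
    and p: "0 < p" "p \<le> 1" "p < 1 \<Longrightarrow> (2 / eps + \<sigma>) * lev X a \<le> p"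
  shows "b \<or> p < 1 \<Longrightarrow> 0 < 1 + step_coeff \<sigma> c p b * lev Y a"
    and "0 \<le> p * (step_coeff \<sigma> c p True / (1 + step_coeff \<sigma> c p True * lev Y a))
      + (1 - p) * (step_coeff \<sigma> c p False / (1 + step_coeff \<sigma> c p False * lev Y a))"
proof -
  define t where "t = lev Y a"
  define l where "l = lev X a"
  have t: "0 < t" "1 / l - (1 - eps / 2) \<le> 1 / t" using lev_shifted_vs_barrier[OF nz] by (auto simp: t_def l_def)
  have l: "0 < l" using lev_barrier_pos[OF nz] by (simp add: l_def)
  have s1: "step_coeff \<sigma> c 1 True = eps / 2" using \<sigma> by (auto simp: step_coeff_def)
  have pos: "0 < 1 + step_coeff \<sigma> c p b * t" if b: "b \<or> p < 1" for b
  proof (cases "p < 1")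
    case False
    then have "p = 1" "b" using p b by auto
    then show ?thesis using s1 eps t by (simp add: add_pos_nonneg)
  next
    case True
    then have pl: "(2 / eps + \<sigma>) * l \<le> p" using p by (simp add: l_def)
    have "(2 / eps + \<sigma>) * l * (1 / l) \<le> p * (1 / l)" using pl l by (intro mult_right_mono) auto
    then have pl': "2 / eps + \<sigma> \<le> p / l" using l by simp
    have e2: "2 < 2 / eps" using eps by (simp add: field_simps)
    have t': "t * (1 / l - (1 - eps / 2)) \<le> 1"
      using mult_left_mono[OF t(2), of t] t(1) by simp
    show ?thesis
    proof (cases "0 \<le> step_coeff \<sigma> c p b")
      case True then show ?thesis using t by (simp add: add_pos_nonneg)
    next
      case neg: False
      \<comment> \<open>A negative coefficient means a kept row at the upper barrier or a dropped
        row at the lower one.\<close>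
      consider "\<sigma> = 1" "b" | "\<sigma> = -1" "\<not> b"
      proof (cases "\<sigma> = 1")
        case True
        then have "b" using neg eps by (cases b) (auto simp: step_coeff_def)
        then show ?thesis using True that by blast
      next
        case False
        then have s: "\<sigma> = -1" using \<sigma> by simp
        have "1 \<le> 1 / p" using p by simp
        then have "\<not> b" using neg s eps by (cases b) (auto simp: step_coeff_def)
        then show ?thesis using s that by blast
      qed
      then have "1 < 1 / t - step_coeff \<sigma> c p b * (-1) + 1"
      proof cases
        case 1
        \<comment> \<open>The target is 1/p < 1/t + c. The extra p eps turns the bound 1/l <= 1/t +
          1 - eps/2 into one with c = 1 + eps/2.\<close>
        have "1 < p / l + p * eps" using pl' 1 e2 p eps by (smt (verit) mult_pos_pos)
        also have "\<dots> = p * (1 / l - (1 - eps / 2) + (1 + eps / 2))" by (simp add: algebra_simps)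
        also have "\<dots> \<le> p * (1 / t + (1 + eps / 2))" using t p by (intro mult_left_mono) auto
        finally have "1 / p < 1 / t + (1 + eps / 2)" using p by (simp add: field_simps)
        then show ?thesis using 1 by (simp add: step_coeff_def)
      next
        case 2
        have "2 / eps - 1 < 1 / l" using pl' 2 True l by (smt (verit) divide_strict_right_mono)
        \<comment> \<open>Together with 2/eps - 1 < 1/l this gives 1/l > 2 - eps; subtracting 1 -
          eps/2 leaves 1/t > 1 - eps/2 = c.\<close>
        moreover have "2 - eps \<le> 2 / eps - 1"
        proof -
          have "0 \<le> (1 - eps) * (2 - eps)" using eps by simp
          then have "(3 - eps) * eps \<le> 2" by (simp add: algebra_simps)
          then show ?thesis using eps by (simp add: pos_le_divide_eq le_diff_eq add.commute)
        qed
        ultimately have "1 - eps / 2 < 1 / t" using t(2) by linarith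
        then show ?thesis using 2 by (simp add: step_coeff_def)
      qed
      then have "0 < (1 / t + step_coeff \<sigma> c p b) * t" using t(1) by (intro mult_pos_pos) auto
      then show ?thesis using t(1) by (simp add: distrib_right)
    qed
  qed
  then show "b \<or> p < 1 \<Longrightarrow> 0 < 1 + step_coeff \<sigma> c p b * lev Y a" by (simp add: t_def)
  show "0 \<le> p * (step_coeff \<sigma> c p True / (1 + step_coeff \<sigma> c p True * lev Y a))
      + (1 - p) * (step_coeff \<sigma> c p False / (1 + step_coeff \<sigma> c p False * lev Y a))"
  proof (cases "p < 1")
    case False
    then show ?thesis using p s1 eps t by (simp add: t_def)
  next
    case True
    define u v where "u = step_coeff \<sigma> c p True" and "v = step_coeff \<sigma> c p False"
    have uv: "0 < 1 + u * t" "0 < 1 + v * t" using pos[of True] pos[of False] True by (auto simp: u_def v_def)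
    have pl: "(2 / eps + \<sigma>) * l \<le> p" using p True by (simp add: l_def)
    \<comment> \<open>The origin of the sampling constants: c = (2/eps + sigma) (eps/2), so p >=
      (2/eps + sigma) l says c <= p eps / (2 l). Passing from 1/l to 1/t costs (eps/2) (1 - eps/2),
      which c^2 absorbs.\<close>
    have key: "c \<le> p * ((eps / 2) / t + c\<^sup>2)"
    proof -
      have c0: "0 < c" using \<sigma> eps by auto
      have "(eps / 2) * (1 / l - (1 - eps / 2)) \<le> (eps / 2) * (1 / t)"
        using t eps by (intro mult_left_mono) auto
      moreover have "(eps / 2) * (1 - eps / 2) \<le> c\<^sup>2"
      proof -
        have "(eps / 2) * (1 - eps / 2) \<le> (1 - eps / 2) * (1 - eps / 2)"
          using eps by (intro mult_right_mono) auto
        also have "\<dots> \<le> c * c" using eps \<sigma> by (intro mult_mono) auto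
        finally show ?thesis by (simp add: power2_eq_square)
      qed
      ultimately have "(eps / 2) / l \<le> (eps / 2) / t + c\<^sup>2" by (simp add: right_diff_distrib)
      then have "p * ((eps / 2) / l) \<le> p * ((eps / 2) / t + c\<^sup>2)" using p by (intro mult_left_mono) auto
      moreover have "c = (2 / eps + \<sigma>) * l * ((eps / 2) / l)"
        using l eps by (simp add: field_simps)
      moreover have "(2 / eps + \<sigma>) * l * ((eps / 2) / l) \<le> p * ((eps / 2) / l)"
        using pl l eps by (intro mult_right_mono) auto
      ultimately show ?thesis by linarith
    qed
    have uv_eq: "u = \<sigma> * (c - 1 / p)" "v = \<sigma> * c" by (simp_all add: u_def v_def step_coeff_def)
    have "\<sigma> * \<sigma> = 1" using \<sigma> by auto
    moreover have "u * v = (\<sigma> * \<sigma>) * (c * (c - 1 / p))" unfolding uv_eq by (simp only: mult_ac)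
    ultimately have prod: "u * v = c * (c - 1 / p)" by simp
    \<comment> \<open>The reweighting by 1/p makes sampling unbiased, so the mean coefficient is
      sigma (c - 1), the same for both barriers.\<close>
    have "p * u + (1 - p) * v = \<sigma> * (p * (c - 1 / p) + (1 - p) * c)"
      unfolding uv_eq by (simp only: distrib_left mult_ac)
    also have "p * (c - 1 / p) + (1 - p) * c = c - 1" using p by (simp add: right_diff_distrib left_diff_distrib)
    also have "\<sigma> * (c - 1) = eps / 2" using \<sigma> by auto
    finally have mean: "p * u + (1 - p) * v = eps / 2" .
    have "p * (u / (1 + u * t)) + (1 - p) * (v / (1 + v * t))
      = (p * u * (1 + v * t) + (1 - p) * v * (1 + u * t)) / ((1 + u * t) * (1 + v * t))"
      using uv add_frac_eq[of "1 + u * t" "1 + v * t" "p * u" "(1 - p) * v"] by simp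
    also have "p * u * (1 + v * t) + (1 - p) * v * (1 + u * t) = (p * u + (1 - p) * v) + (u * v) * t"
      by (simp add: algebra_simps)
    finally have eq: "p * (u / (1 + u * t)) + (1 - p) * (v / (1 + v * t))
      = (eps / 2 + c * (c - 1 / p) * t) / ((1 + u * t) * (1 + v * t))"
      unfolding mean prod .
    have cp: "c * (c - 1 / p) * t = (t / p) * (p * c\<^sup>2 - c)"
      using p by (simp add: power2_eq_square right_diff_distrib left_diff_distrib)
    have ep: "eps / 2 = (t / p) * (p * ((eps / 2) / t))" using p t by simp
    have "k * (p * e) + k * (p * q - r) = k * (p * (e + q) - r)" for k e q r
      by (simp add: algebra_simps)
    note factor = this[of "t / p" "(eps / 2) / t" "c\<^sup>2" c]
    have "eps / 2 + c * (c - 1 / p) * t = (t / p) * (p * ((eps / 2) / t)) + (t / p) * (p * c\<^sup>2 - c)"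
      using cp ep by linarith
    also have "\<dots> = (t / p) * (p * ((eps / 2) / t + c\<^sup>2) - c)"
      by (rule factor)
    also have "\<dots> \<ge> 0" using key t p by (intro mult_nonneg_nonneg) auto
    finally have "0 \<le> (eps / 2 + c * (c - 1 / p) * t) / ((1 + u * t) * (1 + v * t))"
      using uv by (intro divide_nonneg_pos mult_pos_pos)
    then show ?thesis using eq unfolding u_def v_def t_def by linarith
  qed
qed

lemma barrier_step_supermartingale:
  assumes x: "x \<in> carrier_vec d" and nz: "a \<noteq> 0\<^sub>v d"
    and p: "0 < p" "p \<le> 1" "p < 1 \<Longrightarrow> (2 / eps + \<sigma>) * lev X a \<le> p"
  shows "p * lev (T + diff_gram \<sigma> c d (bs @ [a]) (keep_row p a True rs)) x
    + (1 - p) * lev (T + diff_gram \<sigma> c d (bs @ [a]) (keep_row p a False rs)) x \<le> lev Y x"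
proof -
  obtain z where z: "z \<in> carrier_vec d" "Y *\<^sub>v z = x" using pd_solve[OF shifted_pd x] .
  have T': "T + diff_gram \<sigma> c d (bs @ [a]) (keep_row p a b rs) = Y + step_coeff \<sigma> c p b \<cdot>\<^sub>m outer a" for b
    using diff_gram_step[OF bs rs a, of b p \<sigma> c] p T a by (simp add: assoc_add_mat[of _ d d])
  let ?g = "\<lambda>b. step_coeff \<sigma> c p b / (1 + step_coeff \<sigma> c p b * lev Y a)"
  have eq: "lev (T + diff_gram \<sigma> c d (bs @ [a]) (keep_row p a b rs)) x = lev Y x - (a \<bullet> z)\<^sup>2 * ?g b"
    if "b \<or> p < 1" for b
    unfolding T' using lev_rank_one_update(2)[OF shifted_pd a step_coeff_bounds(1)[OF nz p that] z] .
  have "(1 - p) * lev (T + diff_gram \<sigma> c d (bs @ [a]) (keep_row p a False rs)) x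
    = (1 - p) * (lev Y x - (a \<bullet> z)\<^sup>2 * ?g False)"
    using eq[of False] p by (cases "p < 1") auto
  moreover have "p * lev (T + diff_gram \<sigma> c d (bs @ [a]) (keep_row p a True rs)) x
    = p * (lev Y x - (a \<bullet> z)\<^sup>2 * ?g True)"
    using eq[of True] by simp
  moreover have "p * (l - k * g) + (1 - p) * (l - k * h) = l - k * (p * g + (1 - p) * h)" for l k g h
    by (simp add: algebra_simps)
  ultimately have "p * lev (T + diff_gram \<sigma> c d (bs @ [a]) (keep_row p a True rs)) x
    + (1 - p) * lev (T + diff_gram \<sigma> c d (bs @ [a]) (keep_row p a False rs)) x
    = lev Y x - (a \<bullet> z)\<^sup>2 * (p * ?g True + (1 - p) * ?g False)"
    by (simp only:)
  moreover have "0 \<le> (a \<bullet> z)\<^sup>2 * (p * ?g True + (1 - p) * ?g False)"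
    using step_coeff_bounds(2)[OF nz p] by (intro mult_nonneg_nonneg) auto
  ultimately show ?thesis by linarith
qed

end

text \<open>Let y solve X y = a and write l for the barrier score. The threshold l / |y|^2 makes the
  ridge add at most l to y^T X y = l, so the form of the shifted matrix at y is at most 2 l.
  Cauchy-Schwarz then gives l^2 <= 2 l times the shifted score. The threshold depends on the state,
  hence the existential form.\<close>

lemma lev_barrier_le_ridge:
  assumes nz: "a \<noteq> 0\<^sub>v d"
  shows "\<exists>\<theta>\<^sub>0>0. \<forall>\<theta>. 0 < \<theta> \<longrightarrow> \<theta> \<le> \<theta>\<^sub>0 \<longrightarrow>
    lev X a \<le> 2 * lev ((eps / 2) \<cdot>\<^sub>m gram d (bs @ [a]) + \<theta> \<cdot>\<^sub>m 1\<^sub>m d + diff_gram \<sigma> (1 + \<sigma> * eps / 2) d bs rs) a"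
proof -
  obtain y where y: "y \<in> carrier_vec d" "X *\<^sub>v y = a" using barrier_range .
  let ?l = "lev X a"
  have l: "0 < ?l" "?l = a \<bullet> y" using lev_barrier_pos[OF nz] lev_eq_scalar_prod[OF barrier_psd y] by auto
  have "y \<noteq> 0\<^sub>v d" using l a by auto
  then have yy: "0 < y \<bullet> y" using scalar_prod_self_pos[OF y(1)] by simp
  have "lev X a \<le> 2 * lev ((eps / 2) \<cdot>\<^sub>m gram d (bs @ [a]) + \<theta> \<cdot>\<^sub>m 1\<^sub>m d + diff_gram \<sigma> (1 + \<sigma> * eps / 2) d bs rs) a"
    if \<theta>: "0 < \<theta>" "\<theta> \<le> ?l / (y \<bullet> y)" for \<theta>
  proof -
    let ?T = "(eps / 2) \<cdot>\<^sub>m gram d (bs @ [a]) + \<theta> \<cdot>\<^sub>m 1\<^sub>m d"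
    let ?Y = "?T + diff_gram \<sigma> (1 + \<sigma> * eps / 2) d bs rs"
    have T: "?T \<in> carrier_mat d d" "?T\<^sup>T = ?T"
      by (auto intro!: eq_matI simp: gram_index_sym[of _ d])
    have qT: "x \<bullet> (?T *\<^sub>v x) = eps / 2 * (x \<bullet> (gram d (bs @ [a]) *\<^sub>v x)) + \<theta> * (x \<bullet> x)"
      if "x \<in> carrier_vec d" for x
      using that by (simp add: quadratic_form_add[of _ d] quadratic_form_smult[of _ d])
    have ge: "eps / 2 * (x \<bullet> (gram d (bs @ [a]) *\<^sub>v x)) + \<theta> * (x \<bullet> x) \<le> x \<bullet> (?T *\<^sub>v x)"
      if "x \<in> carrier_vec d" for x using qT[OF that] by simp
    note pdY = shifted_pd[OF T \<theta>(1) ge]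
    have psdY: "psd d ?Y" using pdY by (simp add: pd_def)
    obtain w where w: "w \<in> carrier_vec d" "?Y *\<^sub>v w = a" using pd_solve[OF pdY a] .
    have lY: "0 \<le> lev ?Y a" using lev_nonneg[OF psdY w] .
    have yX: "y \<bullet> (X *\<^sub>v y) = ?l" using l(2) y comm_scalar_prod[OF a y(1)] by simp
    have "0 \<le> (1 - eps / 2) * (a \<bullet> y)\<^sup>2" using eps by simp
    then have "y \<bullet> (?Y *\<^sub>v y) \<le> y \<bullet> (X *\<^sub>v y) + \<theta> * (y \<bullet> y)"
      using shifted_quadratic_form[OF T \<theta>(1) ge y(1)] qT[OF y(1)] barrier_quadratic_form[OF y(1)]
      by (simp add: left_diff_distrib)
    also have "\<dots> \<le> 2 * ?l" using \<theta>(2) yy yX by (simp add: pos_le_divide_eq)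
    finally have "lev ?Y a * (y \<bullet> (?Y *\<^sub>v y)) \<le> lev ?Y a * (2 * ?l)"
      using lY by (intro mult_left_mono) auto
    then have "?l * ?l \<le> (2 * lev ?Y a) * ?l"
      using lev_cauchy_schwarz[OF psdY y(1) w] l(2) by (simp add: power2_eq_square)
    then show ?thesis using l(1) by simp
  qed
  then show ?thesis using l yy by (intro exI[of _ "?l / (y \<bullet> y)"]) auto
qed

end

text \<open>Trades the arbitrarily small ridge theta for the fixed ridge m at the cost of a factor
  2. The solution z of the theta-system lies in the range of the Gram matrix G, where m |z|^2 <= z^T
  G z, so the form of G + m I at z is at most 2 z^T G z <= (2/k) z^T K z, with K the matrix of the
  theta-system. Nothing depends on the size of theta.\<close>

lemma lev_scaled_gram_ridge_le:
  assumes bs: "set bs \<subseteq> carrier_vec d" and a: "a \<in> carrier_vec d" and k: "0 < k" and \<theta>: "0 < \<theta>" and m: "0 < m"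
    and low: "\<And>x y. y \<in> carrier_vec d \<Longrightarrow> x = gram d (bs @ [a]) *\<^sub>v y \<Longrightarrow> m * (x \<bullet> x) \<le> x \<bullet> (gram d (bs @ [a]) *\<^sub>v x)"
  shows "lev (k \<cdot>\<^sub>m gram d (bs @ [a]) + \<theta> \<cdot>\<^sub>m 1\<^sub>m d) a \<le> 2 / k * lev (gram d (bs @ [a]) + m \<cdot>\<^sub>m 1\<^sub>m d) a"
proof -
  let ?G = "gram d (bs @ [a])" and ?I = "1\<^sub>m d :: real mat"
  let ?K = "k \<cdot>\<^sub>m ?G + \<theta> \<cdot>\<^sub>m ?I" and ?M = "?G + m \<cdot>\<^sub>m ?I"
  have set: "set (bs @ [a]) \<subseteq> carrier_vec d" using bs a by auto
  have pG: "psd d ?G" using gram_psd[OF set] .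
  have "psd d (k \<cdot>\<^sub>m ?G)"
    using pG k by (auto simp: psd_def quadratic_form_smult[of _ d] gram_index_sym[of _ d] intro!: eq_matI)
  then have pK: "pd d ?K" using pd_add_ridge \<theta> by blast
  then have sK: "psd d ?K" by (simp add: pd_def)
  have pM: "pd d ?M" using pd_add_ridge[OF pG m] .
  then have sM: "psd d ?M" by (simp add: pd_def)
  obtain z where z: "z \<in> carrier_vec d" "?K *\<^sub>v z = a" using pd_solve[OF pK a] .
  obtain w where w: "w \<in> carrier_vec d" "?M *\<^sub>v w = a" using pd_solve[OF pM a] .
  let ?t = "lev ?K a"
  have tz: "?t = a \<bullet> z" using lev_eq_scalar_prod[OF sK z] .
  have t0: "0 \<le> ?t" using lev_nonneg[OF sK z] .
  have lM: "0 \<le> lev ?M a" using lev_nonneg[OF sM w] .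
  show ?thesis
  proof (cases "?t = 0")
    case True then show ?thesis using lM k by simp
  next
    case False
    obtain g where g: "g \<in> carrier_vec d" "?G *\<^sub>v g = a"
      using range_if_square_le_quadratic_form[OF pG a, of 1] gram_psd[OF bs] a
      by (auto simp: gram_snoc[OF bs a] quadratic_form_add[of _ d] outer_quadratic_form[of _ d] psd_def)
    \<comment> \<open>\<open>\<theta> z = a - k G z\<close>, so the solution \<open>z\<close> lies in the range of the Gram matrix.\<close>
    define y where "y = (1 / \<theta>) \<cdot>\<^sub>v (g - k \<cdot>\<^sub>v z)"
    have y: "y \<in> carrier_vec d" unfolding y_def using g z by simp
    have Gz: "?G *\<^sub>v z \<in> carrier_vec d" using z(1) by (simp add: mult_mat_vec_carrier[of _ d d])
    define h where "h = k \<cdot>\<^sub>v (?G *\<^sub>v z)"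
    have h: "h \<in> carrier_vec d" unfolding h_def using Gz by simp
    have "?K *\<^sub>v z = k \<cdot>\<^sub>v (?G *\<^sub>v z) + \<theta> \<cdot>\<^sub>v z"
      using z(1) by (simp add: add_mult_distrib_mat_vec[of _ d d] smult_mat_mult_vec[of _ d d])
    then have az: "a = h + \<theta> \<cdot>\<^sub>v z" unfolding h_def using z(2) by simp
    have "?G *\<^sub>v y = (1 / \<theta>) \<cdot>\<^sub>v (a - h)"
      unfolding y_def h_def using g z(1)
      by (simp add: mult_mat_vec[of _ d d] mult_minus_distrib_mat_vec[of _ d d])
    also have "a - h = \<theta> \<cdot>\<^sub>v z" by (subst az) (use h z(1) in \<open>auto intro!: eq_vecI\<close>)
    also have "(1 / \<theta>) \<cdot>\<^sub>v \<dots> = z" using \<theta> by (simp add: smult_smult_assoc)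
    finally have zy: "z = ?G *\<^sub>v y" by simp
    have q: "z \<bullet> (?K *\<^sub>v z) = ?t" using tz z comm_scalar_prod[OF a z(1)] by simp
    have "k * (z \<bullet> (?M *\<^sub>v z)) \<le> k * (2 * (z \<bullet> (?G *\<^sub>v z)))"
      using low[OF y zy] z(1) k
      by (intro mult_left_mono) (auto simp: quadratic_form_add[of _ d] quadratic_form_smult[of _ d])
    also have "\<dots> \<le> 2 * (z \<bullet> (?K *\<^sub>v z))"
      using z(1) \<theta> scalar_prod_self_nonneg[of z]
      by (simp add: quadratic_form_add[of _ d] quadratic_form_smult[of _ d])
    finally have "z \<bullet> (?M *\<^sub>v z) \<le> 2 / k * ?t" using k unfolding q by (simp add: field_simps)
    then have "lev ?M a * (z \<bullet> (?M *\<^sub>v z)) \<le> lev ?M a * (2 / k * ?t)"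
      using lM by (intro mult_left_mono) auto
    then have "?t * ?t \<le> (2 / k * lev ?M a) * ?t"
      using lev_cauchy_schwarz[OF sM z(1) w] tz by (simp add: power2_eq_square mult_ac)
    then show ?thesis by (rule mult_right_le_imp_le) (use t0 False in simp)
  qed
qed

subsection \<open>The random process\<close>

lemma expectation_bind_finite:
  fixes h :: "'b \<Rightarrow> real"
  assumes M: "finite (set_pmf M)" and f: "\<And>x. x \<in> set_pmf M \<Longrightarrow> finite (set_pmf (f x))"
  shows "measure_pmf.expectation (bind_pmf M f) h = measure_pmf.expectation M (\<lambda>x. measure_pmf.expectation (f x) h)"
  using pmf_expectation_bind[where h = h, OF M f order_refl]
    integral_measure_pmf[where f = "\<lambda>x. measure_pmf.expectation (f x) h", OF M, of M] by simp

lemma expectation_mono_finite: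
  fixes f g :: "'a \<Rightarrow> real"
  assumes M: "finite (set_pmf M)" and le: "\<And>x. x \<in> set_pmf M \<Longrightarrow> f x \<le> g x"
  shows "measure_pmf.expectation M f \<le> measure_pmf.expectation M g"
  using integrable_measure_pmf_finite[OF M] le by (intro integral_mono_AE) (auto simp: AE_measure_pmf_iff)

lemma lev_zero:
  assumes "psd d M"
  shows "lev M (0\<^sub>v d) = 0"
proof -
  have "M *\<^sub>v 0\<^sub>v d = 0\<^sub>v d" using assms by (intro eq_vecI) (auto simp: psd_def)
  then show ?thesis using lev_eq_scalar_prod[OF assms zero_carrier_vec] by simp
qed

text \<open>Zero rows are treated apart throughout: they are sampled with probability 0 and change
  neither barrier, whereas the rank-one analysis divides by scores that vanish for them.\<close>

lemma diff_gram_snoc_zero: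
  assumes "set bs \<subseteq> carrier_vec d"
  shows "diff_gram \<sigma> c d (bs @ [0\<^sub>v d]) rs = diff_gram \<sigma> c d bs rs"
  by (rule eq_matI) (auto simp: diff_gram_def gram_snoc[OF assms] outer_def)

text \<open>The fold of \<open>alg4\<close> before the state is projected to the sampled matrix,
  taken over a list of rows so that prefixes can be treated by induction from the right.\<close>

definition alg4_run :: "real \<Rightarrow> nat \<Rightarrow> real Matrix.vec list \<Rightarrow> alg_state pmf" where
  "alg4_run eps d bs = foldl (\<lambda>M a. bind_pmf M (\<lambda>s. alg4_step eps d s a)) (return_pmf ([], 0\<^sub>m d d, 0\<^sub>m d d)) bs"

lemma alg4_run_Nil: "alg4_run eps d [] = return_pmf ([], 0\<^sub>m d d, 0\<^sub>m d d)"
  by (simp add: alg4_run_def)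

lemma alg4_run_snoc: "alg4_run eps d (bs @ [a]) = bind_pmf (alg4_run eps d bs) (\<lambda>s. alg4_step eps d s a)"
  by (simp add: alg4_run_def)

lemma finite_alg4_step: "finite (set_pmf (alg4_step eps d s a))"
  by (cases s) (simp add: alg4_step_def Let_def)

lemma finite_alg4_run: "finite (set_pmf (alg4_run eps d bs))"
  by (induction bs rule: rev_induct) (auto simp: alg4_run_Nil alg4_run_snoc finite_alg4_step)

text \<open>Only the sampled rows are random, since both \<open>BU\<close> and \<open>BL\<close> are
  multiples of the Gram matrix of the input read so far. The last conjunct, once all rows are read,
  is the spectral approximation.\<close>

definition alg4_inv :: "real \<Rightarrow> nat \<Rightarrow> real Matrix.vec list \<Rightarrow> alg_state \<Rightarrow> bool" where
  "alg4_inv eps d bs s \<longleftrightarrow> (case s of (rs, BU, BL) \<Rightarrow>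
     set rs \<subseteq> carrier_vec d \<and> BU = (1 + eps) \<cdot>\<^sub>m gram d bs \<and> BL = (1 - eps) \<cdot>\<^sub>m gram d bs \<and>
     (\<forall>\<sigma>\<in>{1, -1}. psd d (diff_gram \<sigma> (1 + \<sigma> * eps) d bs rs)))"

section \<open>One step of the algorithm from a state that satisfies the invariant\<close>

context
  fixes eps :: real and d :: nat and bs rs :: "real Matrix.vec list" and BU BL :: "real mat"
    and a :: "real Matrix.vec" and p :: real
  assumes eps: "0 < eps" "eps < 1"
    and bs: "set bs \<subseteq> carrier_vec d" and a: "a \<in> carrier_vec d"
    and inv: "alg4_inv eps d bs (rs, BU, BL)"
  defines "p \<equiv> alg4_prob eps d (rs, BU, BL) a"
begin

lemma alg4_inv_rows: "set rs \<subseteq> carrier_vec d"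
  using inv by (simp add: alg4_inv_def)

lemma alg4_inv_psd: "\<sigma> = 1 \<or> \<sigma> = -1 \<Longrightarrow> psd d (diff_gram \<sigma> (1 + \<sigma> * eps) d bs rs)"
  using inv by (auto simp: alg4_inv_def)

private abbreviation "lev\<^sub>U \<equiv> lev (barrier eps 1 d bs rs a) a"
private abbreviation "lev\<^sub>L \<equiv> lev (barrier eps (-1) d bs rs a) a"

lemma alg4_prob_eq: "p = min ((2 / eps + 1) * lev\<^sub>U + (3 / eps - 1) * lev\<^sub>L) 1"
proof -
  have oa: "outer a \<in> carrier_mat d d" using a by simp
  have "BU - gram d rs + outer a = barrier eps 1 d bs rs a"
    "gram d rs - BL + outer a = barrier eps (-1) d bs rs a"
    using inv oa by (auto simp: alg4_inv_def barrier_def diff_gram_def intro!: eq_matI)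
  then show ?thesis by (simp add: p_def alg4_prob_def Let_def lev_def)
qed

lemma lev_barriers_nonneg: "0 \<le> lev\<^sub>U" "0 \<le> lev\<^sub>L"
  using lev_barrier_nonneg[OF eps _ bs alg4_inv_rows a alg4_inv_psd] by auto

lemma alg4_prob_bounds: "0 \<le> p" "p \<le> 1" "p \<le> 3 / eps * (lev\<^sub>U + lev\<^sub>L)"
proof -
  have e: "1 < 1 / eps" using eps by simp
  have c: "0 \<le> 2 / eps + 1" "2 / eps + 1 \<le> 3 / eps" "0 \<le> 3 / eps - 1" using e eps by (auto simp: field_simps)
  have nn: "0 \<le> (2 / eps + 1) * lev\<^sub>U" "0 \<le> (3 / eps - 1) * lev\<^sub>L"
    using c lev_barriers_nonneg by (auto intro!: mult_nonneg_nonneg)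
  show "0 \<le> p" "p \<le> 1" unfolding alg4_prob_eq using nn by auto
  have "(2 / eps + 1) * lev\<^sub>U \<le> 3 / eps * lev\<^sub>U" "(3 / eps - 1) * lev\<^sub>L \<le> 3 / eps * lev\<^sub>L"
    by (rule mult_right_mono; use c lev_barriers_nonneg in simp)+
  then show "p \<le> 3 / eps * (lev\<^sub>U + lev\<^sub>L)" unfolding alg4_prob_eq distrib_left by linarith
qed

text \<open>For p < 1 the minimum is not truncated and the other barrier contributes a nonnegative
  term. Weakening 3/eps - 1 to 2/eps - 1 gives both signs the common form that the step analysis
  expects.\<close>

lemma alg4_prob_ge_lev:
  assumes \<sigma>: "\<sigma> = 1 \<or> \<sigma> = -1" and "p < 1"
  shows "(2 / eps + \<sigma>) * lev (barrier eps \<sigma> d bs rs a) a \<le> p"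
proof -
  have e: "1 < 1 / eps" using eps by simp
  have c: "0 \<le> 2 / eps + 1" "2 / eps - 1 \<le> 3 / eps - 1" "0 \<le> 3 / eps - 1" using e eps by (auto simp: field_simps)
  have nn: "0 \<le> (2 / eps + 1) * lev\<^sub>U" "0 \<le> (3 / eps - 1) * lev\<^sub>L"
    using c lev_barriers_nonneg by (auto intro!: mult_nonneg_nonneg)
  have "(2 / eps - 1) * lev\<^sub>L \<le> (3 / eps - 1) * lev\<^sub>L"
    using c lev_barriers_nonneg by (intro mult_right_mono) auto
  moreover have "p = (2 / eps + 1) * lev\<^sub>U + (3 / eps - 1) * lev\<^sub>L"
    using alg4_prob_eq \<open>p < 1\<close> by linarith
  ultimately show ?thesis using \<sigma> nn by auto
qed

lemma alg4_prob_pos: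
  assumes nz: "a \<noteq> 0\<^sub>v d"
  shows "0 < p"
proof -
  have "0 < (2 / eps + 1) * lev\<^sub>U"
    using lev_barrier_pos[OF eps _ bs alg4_inv_rows a alg4_inv_psd nz] eps by (intro mult_pos_pos) (auto intro!: add_pos_pos)
  moreover have "1 < 1 / eps" using eps by simp
  then have "0 \<le> (3 / eps - 1) * lev\<^sub>L"
    using lev_barriers_nonneg by (intro mult_nonneg_nonneg) auto
  ultimately show ?thesis unfolding alg4_prob_eq by auto
qed

lemma alg4_prob_zero:
  assumes z: "a = 0\<^sub>v d"
  shows "p = 0"
proof -
  have "lev\<^sub>U = 0" "lev\<^sub>L = 0"
    using lev_zero[OF barrier_psd[OF eps _ bs alg4_inv_rows a alg4_inv_psd]] unfolding z by auto
  then show ?thesis unfolding alg4_prob_eq by simp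
qed

lemma alg4_step_eq:
  "alg4_step eps d (rs, BU, BL) a = map_pmf (\<lambda>b. (keep_row p a b rs,
     BU + (1 + eps) \<cdot>\<^sub>m outer a, BL + (1 - eps) \<cdot>\<^sub>m outer a)) (bernoulli_pmf p)"
  by (simp add: alg4_step_def Let_def keep_row_def p_def)

lemma expectation_alg4_step:
  fixes h :: "alg_state \<Rightarrow> real"
  shows "measure_pmf.expectation (alg4_step eps d (rs, BU, BL) a) h =
    p * h (keep_row p a True rs, BU + (1 + eps) \<cdot>\<^sub>m outer a, BL + (1 - eps) \<cdot>\<^sub>m outer a)
    + (1 - p) * h (keep_row p a False rs, BU + (1 + eps) \<cdot>\<^sub>m outer a, BL + (1 - eps) \<cdot>\<^sub>m outer a)"
  unfolding alg4_step_eq integral_map_pmf using alg4_prob_bounds by (simp add: mult.commute)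

lemma alg4_inv_step:
  assumes "s \<in> set_pmf (alg4_step eps d (rs, BU, BL) a)"
  shows "alg4_inv eps d (bs @ [a]) s"
proof -
  obtain b where b: "b \<in> set_pmf (bernoulli_pmf p)"
    and s: "s = (keep_row p a b rs, BU + (1 + eps) \<cdot>\<^sub>m outer a, BL + (1 - eps) \<cdot>\<^sub>m outer a)"
    using assms unfolding alg4_step_eq by auto
  \<comment> \<open>Membership in the support excludes keeping a row with p = 0 and dropping one
    with p = 1; this is how the invariant holds surely.\<close>
  have pb: "if b then 0 < p else p < 1"
    using b alg4_prob_bounds by (auto simp: set_pmf_iff pmf_bernoulli_True pmf_bernoulli_False split: if_splits)
  have oa: "outer a \<in> carrier_mat d d" using a by simp
  have BU: "BU + (1 + eps) \<cdot>\<^sub>m outer a = (1 + eps) \<cdot>\<^sub>m gram d (bs @ [a])"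
    and BL: "BL + (1 - eps) \<cdot>\<^sub>m outer a = (1 - eps) \<cdot>\<^sub>m gram d (bs @ [a])"
    using inv oa by (auto simp: alg4_inv_def gram_snoc[OF bs a] algebra_simps intro!: eq_matI)
  have "psd d (diff_gram \<sigma> (1 + \<sigma> * eps) d (bs @ [a]) (keep_row p a b rs))"
    if \<sigma>: "\<sigma> = 1 \<or> \<sigma> = -1" for \<sigma>
  proof (cases "a = 0\<^sub>v d")
    case True
    then have "\<not> b" using pb alg4_prob_zero by (cases b) auto
    then show ?thesis using alg4_inv_psd[OF \<sigma>] True by (simp add: keep_row_def diff_gram_snoc_zero[OF bs])
  next
    case False
    have "b \<or> p < 1" using pb by (cases b) auto
    then show ?thesis
      using diff_gram_psd_step[OF eps \<sigma> bs alg4_inv_rows a alg4_inv_psd[OF \<sigma>] alg4_prob_pos[OF False] alg4_prob_bounds(2) alg4_prob_ge_lev[OF \<sigma>]]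
      by blast
  qed
  from this[of 1] this[of "-1"] show ?thesis
    unfolding s alg4_inv_def using BU BL keep_row_carrier[OF alg4_inv_rows a] by auto
qed

end

lemma alg4_run_inv:
  assumes eps: "0 < eps" "eps < 1" and "set bs \<subseteq> carrier_vec d" and "s \<in> set_pmf (alg4_run eps d bs)"
  shows "alg4_inv eps d bs s"
  using assms(3,4)
proof (induction bs arbitrary: s rule: rev_induct)
  case Nil
  have "diff_gram \<sigma> c d [] [] = 0\<^sub>m d d" for \<sigma> c
    by (rule eq_matI) (auto simp: diff_gram_def gram_Nil)
  moreover have "psd d (0\<^sub>m d d)"
    using gram_psd[of "[]" d] by (simp add: gram_Nil)
  ultimately show ?case using Nil by (auto simp: alg4_run_Nil alg4_inv_def gram_Nil)
next
  case (snoc a bs)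
  then obtain t where t: "t \<in> set_pmf (alg4_run eps d bs)" "s \<in> set_pmf (alg4_step eps d t a)"
    by (auto simp: alg4_run_snoc)
  obtain rs BU BL where tt: "t = (rs, BU, BL)" by (cases t) auto
  have "alg4_inv eps d bs (rs, BU, BL)" using snoc.IH[of t] t(1) snoc.prems unfolding tt by simp
  then show ?case using alg4_inv_step[OF eps _ _ _ t(2)[unfolded tt]] snoc.prems by simp
qed

text \<open>\<open>T\<close> stays fixed while the prefix grows. The lower bound demanded of
  \<open>T\<close> passes to shorter prefixes because Gram matrices grow with their rows, and at the
  empty prefix the random part is zero, which leaves \<open>lev T x\<close>. The vector
  \<open>x\<close> is arbitrary so that it can be a row still to come.\<close>

lemma barrier_supermartingale:
  assumes eps: "0 < eps" "eps < 1" and \<sigma>: "\<sigma> = 1 \<or> \<sigma> = -1" and x: "x \<in> carrier_vec d"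
    and T: "T \<in> carrier_mat d d" "T\<^sup>T = T" and \<theta>: "0 < \<theta>"
    and "set bs \<subseteq> carrier_vec d"
    and "\<And>v. v \<in> carrier_vec d \<Longrightarrow> eps / 2 * (v \<bullet> (gram d bs *\<^sub>v v)) + \<theta> * (v \<bullet> v) \<le> v \<bullet> (T *\<^sub>v v)"
  shows "measure_pmf.expectation (alg4_run eps d bs)
    (\<lambda>s. lev (T + diff_gram \<sigma> (1 + \<sigma> * eps / 2) d bs (fst s)) x) \<le> lev T x"
  using assms(8,9)
proof (induction bs rule: rev_induct)
  case Nil
  have "T + diff_gram \<sigma> (1 + \<sigma> * eps / 2) d [] [] = T"
    using T by (intro eq_matI) (auto simp: diff_gram_def gram_Nil)
  then show ?case by (simp add: alg4_run_Nil)
next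
  case (snoc a bs)
  have a: "a \<in> carrier_vec d" and bs: "set bs \<subseteq> carrier_vec d" using snoc.prems by auto
  note T_ge = snoc.prems(2)
  let ?h = "\<lambda>bs s. lev (T + diff_gram \<sigma> (1 + \<sigma> * eps / 2) d bs (fst (s :: alg_state))) x"
  have "measure_pmf.expectation (alg4_run eps d (bs @ [a])) (?h (bs @ [a]))
    = measure_pmf.expectation (alg4_run eps d bs) (\<lambda>s. measure_pmf.expectation (alg4_step eps d s a) (?h (bs @ [a])))"
    unfolding alg4_run_snoc by (rule expectation_bind_finite[OF finite_alg4_run finite_alg4_step])
  also have "\<dots> \<le> measure_pmf.expectation (alg4_run eps d bs) (?h bs)"
  proof (rule expectation_mono_finite[OF finite_alg4_run])
    fix s assume s: "s \<in> set_pmf (alg4_run eps d bs)"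
    obtain rs BU BL where ss: "s = (rs, BU, BL)" by (cases s) auto
    have inv: "alg4_inv eps d bs (rs, BU, BL)" using alg4_run_inv[OF eps bs s] by (simp add: ss)
    show "measure_pmf.expectation (alg4_step eps d s a) (?h (bs @ [a])) \<le> ?h bs s"
    proof (cases "a = 0\<^sub>v d")
      case True
      show ?thesis
        unfolding ss expectation_alg4_step[OF eps bs a inv] using alg4_prob_zero[OF eps bs a inv True]
        by (simp add: keep_row_def True diff_gram_snoc_zero[OF bs])
    next
      case False
      show ?thesis
        unfolding ss expectation_alg4_step[OF eps bs a inv] fst_conv
        by (rule barrier_step_supermartingale[OF eps \<sigma> bs alg4_inv_rows[OF eps bs a inv] a alg4_inv_psd[OF eps bs a inv \<sigma>] T \<theta> T_ge x False
              alg4_prob_pos[OF eps bs a inv False] alg4_prob_bounds(2)[OF eps bs a inv] alg4_prob_ge_lev[OF eps bs a inv \<sigma>]])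
    qed
  qed
  also have "\<dots> \<le> lev T x"
  proof (rule snoc.IH[OF bs])
    fix v :: "real Matrix.vec" assume v: "v \<in> carrier_vec d"
    have "v \<bullet> (gram d bs *\<^sub>v v) \<le> v \<bullet> (gram d (bs @ [a]) *\<^sub>v v)"
      using v a by (simp add: gram_snoc[OF bs a] quadratic_form_add[of _ d] outer_quadratic_form[of _ d])
    then have "eps / 2 * (v \<bullet> (gram d bs *\<^sub>v v)) \<le> eps / 2 * (v \<bullet> (gram d (bs @ [a]) *\<^sub>v v))"
      using eps by (intro mult_left_mono) auto
    then show "eps / 2 * (v \<bullet> (gram d bs *\<^sub>v v)) + \<theta> * (v \<bullet> v) \<le> v \<bullet> (T *\<^sub>v v)"
      using T_ge[OF v] by linarith
  qed
  finally show ?case .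
qed

text \<open>The factor 8/eps is 2 * (4/eps): the 2 comes from replacing the barrier by its
  ridge-shifted version, and 4/eps is 2/k for k = eps/2 in the bound on the initial score.\<close>

lemma expected_lev_barrier_le:
  assumes eps: "0 < eps" "eps < 1" and \<sigma>: "\<sigma> = 1 \<or> \<sigma> = -1" and m: "0 < m"
    and bs: "set bs \<subseteq> carrier_vec d" and a: "a \<in> carrier_vec d" and nz: "a \<noteq> 0\<^sub>v d"
    and low: "\<And>x y. y \<in> carrier_vec d \<Longrightarrow> x = gram d (bs @ [a]) *\<^sub>v y \<Longrightarrow> m * (x \<bullet> x) \<le> x \<bullet> (gram d (bs @ [a]) *\<^sub>v x)"
  shows "measure_pmf.expectation (alg4_run eps d bs) (\<lambda>s. lev (barrier eps \<sigma> d bs (fst s) a) a)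
    \<le> 8 / eps * lev (gram d (bs @ [a]) + m \<cdot>\<^sub>m 1\<^sub>m d) a"
proof -
  let ?T = "\<lambda>\<theta>. (eps / 2) \<cdot>\<^sub>m gram d (bs @ [a]) + \<theta> \<cdot>\<^sub>m 1\<^sub>m d"
  let ?R = "alg4_run eps d bs"
  let ?Y = "\<lambda>\<theta> s. lev (?T \<theta> + diff_gram \<sigma> (1 + \<sigma> * eps / 2) d bs (fst (s :: alg_state))) a"
  have "\<forall>s \<in> set_pmf ?R. \<exists>\<theta>\<^sub>0>0. \<forall>\<theta>. 0 < \<theta> \<longrightarrow> \<theta> \<le> \<theta>\<^sub>0 \<longrightarrow> lev (barrier eps \<sigma> d bs (fst s) a) a \<le> 2 * ?Y \<theta> s"
  proof
    fix s assume s: "s \<in> set_pmf ?R"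
    obtain rs BU BL where ss: "s = (rs, BU, BL)" by (cases s) auto
    have inv: "alg4_inv eps d bs (rs, BU, BL)" using alg4_run_inv[OF eps bs s] by (simp add: ss)
    show "\<exists>\<theta>\<^sub>0>0. \<forall>\<theta>. 0 < \<theta> \<longrightarrow> \<theta> \<le> \<theta>\<^sub>0 \<longrightarrow> lev (barrier eps \<sigma> d bs (fst s) a) a \<le> 2 * ?Y \<theta> s"
      unfolding ss fst_conv
      by (rule lev_barrier_le_ridge[OF eps \<sigma> bs alg4_inv_rows[OF eps bs a inv] a alg4_inv_psd[OF eps bs a inv \<sigma>] nz])
  qed
  then obtain \<theta>\<^sub>0 where \<theta>\<^sub>0: "\<And>s. s \<in> set_pmf ?R \<Longrightarrow> 0 < \<theta>\<^sub>0 s"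
    "\<And>s \<theta>. s \<in> set_pmf ?R \<Longrightarrow> 0 < \<theta> \<Longrightarrow> \<theta> \<le> \<theta>\<^sub>0 s \<Longrightarrow> lev (barrier eps \<sigma> d bs (fst s) a) a \<le> 2 * ?Y \<theta> s"
    by (auto dest!: bchoice)
  \<comment> \<open>A single ridge for all reachable states; the minimum is positive because the
    support is finite.\<close>
  define \<theta> where "\<theta> = Min (\<theta>\<^sub>0 ` set_pmf ?R)"
  have fin: "finite (\<theta>\<^sub>0 ` set_pmf ?R)" "\<theta>\<^sub>0 ` set_pmf ?R \<noteq> {}"
    using finite_alg4_run by (auto simp: set_pmf_not_empty)
  have \<theta>: "0 < \<theta>" unfolding \<theta>_def using fin \<theta>\<^sub>0(1) by simp
  have le: "\<theta> \<le> \<theta>\<^sub>0 s" if "s \<in> set_pmf ?R" for s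
    unfolding \<theta>_def using fin that by simp
  have T: "?T \<theta> \<in> carrier_mat d d" "(?T \<theta>)\<^sup>T = ?T \<theta>"
    by (auto intro!: eq_matI simp: gram_index_sym[of _ d])
  have T_ge: "eps / 2 * (v \<bullet> (gram d bs *\<^sub>v v)) + \<theta> * (v \<bullet> v) \<le> v \<bullet> (?T \<theta> *\<^sub>v v)" if v: "v \<in> carrier_vec d" for v
  proof -
    have "0 \<le> eps / 2 * (a \<bullet> v)\<^sup>2" using eps by simp
    then show ?thesis
      using v a by (simp add: gram_snoc[OF bs a] quadratic_form_add[of _ d] quadratic_form_smult[of _ d]
          outer_quadratic_form[of _ d] distrib_left)
  qed
  have "measure_pmf.expectation ?R (\<lambda>s. lev (barrier eps \<sigma> d bs (fst s) a) a) \<le> measure_pmf.expectation ?R (\<lambda>s. 2 * ?Y \<theta> s)"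
    using \<theta>\<^sub>0(2)[OF _ \<theta> le] by (intro expectation_mono_finite[OF finite_alg4_run]) auto
  also have "\<dots> = 2 * measure_pmf.expectation ?R (?Y \<theta>)" by simp
  also have "\<dots> \<le> 2 * lev (?T \<theta>) a"
    using barrier_supermartingale[OF eps \<sigma> a T \<theta> bs T_ge] by (intro mult_left_mono) auto
  also have "\<dots> \<le> 2 * (2 / (eps / 2) * lev (gram d (bs @ [a]) + m \<cdot>\<^sub>m 1\<^sub>m d) a)"
    using lev_scaled_gram_ridge_le[OF bs a _ \<theta> m low, of "eps / 2"] eps by (intro mult_left_mono) auto
  finally show ?thesis by simp
qed

text \<open>A step adds \<open>p\<close> rows in expectation, and \<open>p\<close> is at most 3/eps
  times the sum of both barrier scores, so linearity of expectation reduces the count to the bound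
  for each single row.\<close>

lemma expected_length_le:
  assumes eps: "0 < eps" "eps < 1" and m: "0 < m" and "set bs \<subseteq> carrier_vec d"
    and "\<And>i x y. \<lbrakk>1 \<le> i; i \<le> length bs; y \<in> carrier_vec d; x = gram d (take i bs) *\<^sub>v y\<rbrakk>
      \<Longrightarrow> m * (x \<bullet> x) \<le> x \<bullet> (gram d (take i bs) *\<^sub>v x)"
  shows "measure_pmf.expectation (alg4_run eps d bs) (\<lambda>s. real (length (fst s))) \<le> 48 / eps\<^sup>2 * ridge_lev_sum d m bs"
  using assms(4,5)
proof (induction bs rule: rev_induct)
  case Nil
  then show ?case by (simp add: alg4_run_Nil ridge_lev_sum_def)
next
  case (snoc a bs)
  have a: "a \<in> carrier_vec d" and bs: "set bs \<subseteq> carrier_vec d" using snoc.prems by auto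
  let ?R = "alg4_run eps d bs"
  let ?E = "measure_pmf.expectation ?R"
  let ?l = "\<lambda>\<sigma> s. lev (barrier eps \<sigma> d bs (fst (s :: alg_state)) a) a"
  let ?r = "lev (gram d (bs @ [a]) + m \<cdot>\<^sub>m 1\<^sub>m d) a"
  have int: "integrable ?R f" for f :: "alg_state \<Rightarrow> real"
    by (rule integrable_measure_pmf_finite[OF finite_alg4_run])
  have "measure_pmf.expectation (alg4_run eps d (bs @ [a])) (\<lambda>s. real (length (fst s)))
    = ?E (\<lambda>s. measure_pmf.expectation (alg4_step eps d s a) (\<lambda>s. real (length (fst s))))"
    unfolding alg4_run_snoc by (rule expectation_bind_finite[OF finite_alg4_run finite_alg4_step])
  also have "\<dots> \<le> ?E (\<lambda>s. real (length (fst s)) + alg4_prob eps d s a)"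
  proof (rule expectation_mono_finite[OF finite_alg4_run])
    fix s assume s: "s \<in> set_pmf ?R"
    obtain rs BU BL where ss: "s = (rs, BU, BL)" by (cases s) auto
    have inv: "alg4_inv eps d bs (rs, BU, BL)" using alg4_run_inv[OF eps bs s] by (simp add: ss)
    show "measure_pmf.expectation (alg4_step eps d s a) (\<lambda>s. real (length (fst s)))
      \<le> real (length (fst s)) + alg4_prob eps d s a"
      unfolding ss expectation_alg4_step[OF eps bs a inv] by (simp add: keep_row_def algebra_simps)
  qed
  also have "\<dots> = ?E (\<lambda>s. real (length (fst s))) + ?E (\<lambda>s. alg4_prob eps d s a)"
    by (rule Bochner_Integration.integral_add[OF int int])
  also have "?E (\<lambda>s. real (length (fst s))) \<le> 48 / eps\<^sup>2 * ridge_lev_sum d m bs"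
  proof (rule snoc.IH[OF bs])
    fix i x y assume "1 \<le> i" "i \<le> length bs" "y \<in> carrier_vec d" "x = gram d (take i bs) *\<^sub>v y"
    then show "m * (x \<bullet> x) \<le> x \<bullet> (gram d (take i bs) *\<^sub>v x)" using snoc.prems(2)[of i y x] by simp
  qed
  also have "?E (\<lambda>s. alg4_prob eps d s a) \<le> 48 / eps\<^sup>2 * ?r"
  proof (cases "a = 0\<^sub>v d")
    case True
    have "alg4_prob eps d s a \<le> 0" if s: "s \<in> set_pmf ?R" for s
    proof -
      obtain rs BU BL where ss: "s = (rs, BU, BL)" by (cases s) auto
      have inv: "alg4_inv eps d bs (rs, BU, BL)" using alg4_run_inv[OF eps bs s] by (simp add: ss)
      show ?thesis using alg4_prob_zero[OF eps bs a inv True] by (simp add: ss)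
    qed
    then have "?E (\<lambda>s. alg4_prob eps d s a) \<le> ?E (\<lambda>s. 0)"
      by (intro expectation_mono_finite[OF finite_alg4_run])
    moreover have "?r = 0"
      using lev_zero pd_add_ridge[OF gram_psd[OF snoc.prems(1)] m] True unfolding pd_def by blast
    ultimately show ?thesis by simp
  next
    case False
    have low: "m * (x \<bullet> x) \<le> x \<bullet> (gram d (bs @ [a]) *\<^sub>v x)"
      if "y \<in> carrier_vec d" "x = gram d (bs @ [a]) *\<^sub>v y" for x y
      using snoc.prems(2)[of "Suc (length bs)" y x] that by simp
    have "?E (\<lambda>s. alg4_prob eps d s a) \<le> ?E (\<lambda>s. 3 / eps * (?l 1 s + ?l (-1) s))"
    proof (rule expectation_mono_finite[OF finite_alg4_run])
      fix s assume s: "s \<in> set_pmf ?R"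
      obtain rs BU BL where ss: "s = (rs, BU, BL)" by (cases s) auto
      have inv: "alg4_inv eps d bs (rs, BU, BL)" using alg4_run_inv[OF eps bs s] by (simp add: ss)
      show "alg4_prob eps d s a \<le> 3 / eps * (?l 1 s + ?l (-1) s)"
        using alg4_prob_bounds(3)[OF eps bs a inv] by (simp add: ss)
    qed
    also have "\<dots> = 3 / eps * (?E (?l 1) + ?E (?l (-1)))"
      by (simp add: Bochner_Integration.integral_add[OF int int])
    \<comment> \<open>The coefficient 48 / eps^2 is (3/eps) * (8/eps + 8/eps), one summand for each
      barrier.\<close>
    also have "\<dots> \<le> 3 / eps * (8 / eps * ?r + 8 / eps * ?r)"
      using expected_lev_barrier_le[OF eps _ m bs a False low] eps
      by (intro mult_left_mono add_mono) auto
    also have "\<dots> = 48 / eps\<^sup>2 * ?r" by (simp add: power2_eq_square)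
    finally show ?thesis .
  qed
  finally show ?case by (simp add: ridge_lev_sum_snoc distrib_left)
qed

section \<open>From states to the output matrix\<close>

lemma alg4_eq_map_run:
  "A \<in> carrier_mat n d \<Longrightarrow> alg4 eps A = map_pmf (\<lambda>s. mat_of_rows d (fst s)) (alg4_run eps d (Matrix.rows A))"
  by (auto simp: alg4_def Let_def alg4_run_def case_prod_unfold)

lemma alg4_inv_spectral_approx:
  assumes A: "A \<in> carrier_mat n d" and inv: "alg4_inv eps d (Matrix.rows A) s"
  shows "spectral_approx eps A (mat_of_rows d (fst s))"
proof -
  let ?G = "gram d (Matrix.rows A)" and ?H = "gram d (fst s)"
  have G: "A\<^sup>T * A = ?G" using gram_rows[OF A] by simp
  have H: "(mat_of_rows d (fst s))\<^sup>T * mat_of_rows d (fst s) = ?H" by (simp add: gram_def)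
  have psd: "0 \<le> \<sigma> * ((1 + \<sigma> * eps) * (x \<bullet> (?G *\<^sub>v x)) - x \<bullet> (?H *\<^sub>v x))"
    if "x \<in> carrier_vec d" "\<sigma> \<in> {1, -1}" for x \<sigma>
  proof -
    have "psd d (diff_gram \<sigma> (1 + \<sigma> * eps) d (Matrix.rows A) (fst s))"
      using inv that(2) by (cases s) (auto simp: alg4_inv_def)
    then show ?thesis
      unfolding diff_gram_quadratic_form[OF that(1), symmetric] using that(1) unfolding psd_def by blast
  qed
  show ?thesis
    unfolding spectral_approx_def loewner_le_def G H
    using A psd[of _ 1] psd[of _ "-1"] by (auto simp: quadratic_form_smult[of _ d])
qed

lemma alg4_expected_rows:
  assumes A: "A \<in> carrier_mat n d" and eps: "0 < eps" "eps < 1"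
  shows "measure_pmf.expectation (alg4 eps A) (\<lambda>At. real (dim_row At))
    \<le> 48 * (real (mrank A) / eps\<^sup>2 * ln (mu A) + real (mrank A) / eps\<^sup>2)"
proof -
  have rc: "set (Matrix.rows A) \<subseteq> carrier_vec d" using rows_carrier[OF A] .
  have E: "measure_pmf.expectation (alg4 eps A) (\<lambda>At. real (dim_row At))
    = measure_pmf.expectation (alg4_run eps d (Matrix.rows A)) (\<lambda>s. real (length (fst s)))"
    unfolding alg4_eq_map_run[OF A] by simp
  have bound: "measure_pmf.expectation (alg4 eps A) (\<lambda>At. real (dim_row At))
      \<le> 48 / eps\<^sup>2 * (real (mrank A) * ln (1 + (spec_norm A)\<^sup>2 / m))"
    if m: "0 < m" and low: "\<And>i x y. \<lbrakk>1 \<le> i; i \<le> n; y \<in> carrier_vec d; x = gram d (take i (Matrix.rows A)) *\<^sub>v y\<rbrakk>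
      \<Longrightarrow> m * (x \<bullet> x) \<le> x \<bullet> (gram d (take i (Matrix.rows A)) *\<^sub>v x)" for m
  proof -
    have "measure_pmf.expectation (alg4 eps A) (\<lambda>At. real (dim_row At))
      \<le> 48 / eps\<^sup>2 * ridge_lev_sum d m (Matrix.rows A)"
      unfolding E by (rule expected_length_le[OF eps m rc]) (use low A in auto)
    also have "\<dots> \<le> 48 / eps\<^sup>2 * (real (mrank A) * ln (1 + (spec_norm A)\<^sup>2 / m))"
      using ridge_lev_sum_le[OF A m] by (intro mult_left_mono) auto
    finally show ?thesis .
  qed
  show ?thesis
  proof (cases "A = 0\<^sub>m n d")
    case True
    \<comment> \<open>For the zero matrix m = 1 may be taken, as every prefix Gram matrix has
      trivial range. The spectral norm is 0, so the logarithm is ln 1 and the bound collapses to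
      0.\<close>
    have "measure_pmf.expectation (alg4 eps A) (\<lambda>At. real (dim_row At))
      \<le> 48 / eps\<^sup>2 * (real (mrank A) * ln (1 + (spec_norm A)\<^sup>2 / 1))"
    proof (rule bound)
      fix i x y assume y: "y \<in> carrier_vec d" and x: "x = gram d (take i (Matrix.rows A)) *\<^sub>v y"
      have tc: "set (take i (Matrix.rows A)) \<subseteq> carrier_vec d" using rc set_take_subset by fastforce
      have "r \<bullet> y = 0" if "r \<in> set (take i (Matrix.rows A))" for r
        using in_set_takeD[OF that] y unfolding True by (auto simp: Matrix.rows_def)
      then have "map (\<lambda>r. (r \<bullet> y)\<^sup>2) (take i (Matrix.rows A)) = map (\<lambda>r. 0) (take i (Matrix.rows A))"
        by (intro map_cong) auto
      then have "y \<bullet> (gram d (take i (Matrix.rows A)) *\<^sub>v y) = 0"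
        unfolding gram_quadratic_form[OF tc y] by (simp only: sum_list_0)
      then have "x = 0\<^sub>v d" unfolding x by (rule psd_quadratic_form_eq_0[OF gram_psd[OF tc] y])
      then show "1 * (x \<bullet> x) \<le> x \<bullet> (gram d (take i (Matrix.rows A)) *\<^sub>v x)"
        using gram_psd[OF tc] by (simp add: psd_def)
    qed simp
    also have "\<dots> = 0" using spec_norm_zero[OF True] by simp
    \<comment> \<open>Here the minimum in \<open>mu\<close> is over the empty set, but the numerator
      is 0, so \<open>mu A = 0\<close>; with the convention \<open>ln 0 = 0\<close> the right-hand
      side is nonnegative.\<close>
    also have "0 \<le> 48 * (real (mrank A) / eps\<^sup>2 * ln (mu A) + real (mrank A) / eps\<^sup>2)"
      using spec_norm_zero[OF True] by (simp add: mu_def)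
    finally show ?thesis .
  next
    case False
    obtain m where m: "0 < m" "mu A = (spec_norm A)\<^sup>2 / m" "m \<le> (spec_norm A)\<^sup>2"
      "\<And>i x y. \<lbrakk>1 \<le> i; i \<le> n; y \<in> carrier_vec d; x = gram d (take i (Matrix.rows A)) *\<^sub>v y\<rbrakk>
        \<Longrightarrow> m * (x \<bullet> x) \<le> x \<bullet> (gram d (take i (Matrix.rows A)) *\<^sub>v x)"
      using mu_witness[OF A False] by metis
    have mu1: "1 \<le> mu A" using m by simp
    \<comment> \<open>The additive term r / eps^2 of the theorem originates here: since
      \<open>mu A\<close> is at least 1, replacing ln (1 + mu) by ln mu costs at most ln 2 < 1 per
      unit of rank.\<close>
    have "ln (1 + mu A) \<le> ln (2 * mu A)" using mu1 by simp
    also have "\<dots> = ln 2 + ln (mu A)" using mu1 by (simp add: ln_mult_pos)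
    also have "\<dots> \<le> ln (mu A) + 1" using ln_2_less_1 by linarith
    finally have "real (mrank A) * ln (1 + mu A) \<le> real (mrank A) * (ln (mu A) + 1)"
      by (intro mult_left_mono) auto
    then have "48 / eps\<^sup>2 * (real (mrank A) * ln (1 + mu A)) \<le> 48 / eps\<^sup>2 * (real (mrank A) * (ln (mu A) + 1))"
      by (rule mult_left_mono) auto
    also have "\<dots> = 48 * (real (mrank A) / eps\<^sup>2 * ln (mu A) + real (mrank A) / eps\<^sup>2)"
      by (simp add: algebra_simps add_divide_distrib)
    finally have "48 / eps\<^sup>2 * (real (mrank A) * ln (1 + mu A)) \<le> \<dots>" .
    moreover have "measure_pmf.expectation (alg4 eps A) (\<lambda>At. real (dim_row At))
      \<le> 48 / eps\<^sup>2 * (real (mrank A) * ln (1 + mu A))"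
      unfolding m(2) by (rule bound[OF m(1)]) (rule m(4))
    ultimately show ?thesis by linarith
  qed
qed

theorem mainTheorem2:
  "\<exists>C > 0. \<forall>(A :: real mat) n d (eps :: real).
     A \<in> carrier_mat n d \<longrightarrow> 0 < eps \<longrightarrow> eps < 1 \<longrightarrow>
     (\<forall>At \<in> set_pmf (alg4 eps A). spectral_approx eps A At) \<and>
     measure_pmf.expectation (alg4 eps A) (\<lambda>At. real (dim_row At))
       \<le> C * (real (mrank A) / eps\<^sup>2 * ln (mu A) + real (mrank A) / eps\<^sup>2)"
proof (intro exI[of _ 48] conjI allI impI ballI)
  fix A :: "real mat" and n d and eps :: real and At
  assume A: "A \<in> carrier_mat n d" and eps: "0 < eps" "eps < 1"
  show "measure_pmf.expectation (alg4 eps A) (\<lambda>At. real (dim_row At))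
       \<le> 48 * (real (mrank A) / eps\<^sup>2 * ln (mu A) + real (mrank A) / eps\<^sup>2)"
    using alg4_expected_rows[OF A eps] .
  assume "At \<in> set_pmf (alg4 eps A)"
  then obtain s where "s \<in> set_pmf (alg4_run eps d (Matrix.rows A))" "At = mat_of_rows d (fst s)"
    unfolding alg4_eq_map_run[OF A] by auto
  then show "spectral_approx eps A At"
    using alg4_inv_spectral_approx[OF A alg4_run_inv[OF eps rows_carrier[OF A]]] by simp
qed simp

end
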